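(* Let $\mathcal{X}$ be a Polish space and $G$ a locally compact, $\sigma$-compact, Hausdorff, unimodular topological group with Haar measure $\lambda$, acting on $\mathcal{X}$ by a jointly measurable action $\varphi$. Let $k:\mathcal{X}\times\mathcal{X}\to\mathbb{R}$ be a continuous, bounded, positive definite kernel which is characteristic on the space $\mathcal{M}_f(\mathcal{X})$ of finite signed Borel measures on $\mathcal{X}$, let $\rho:\mathcal{X}\to(0,\infty)$ be continuous and bounded, and assume $\lambda\in\mathcal{M}^\rho(G)$. Then the kernel $k^\rho_\lambda$ is constant on orbits and induces a measurable positive definite kernel $\widetilde{k}^\rho_\lambda$ on $\mathcal{X}/G$, defined by $\widetilde{k}^\rho_\lambda([x],[y])=k^\rho_\lambda(x,y)$, and $\widetilde{k}^\rho_\lambda$ is characteristic on the set $\Pi_*\mathcal{P}(\mathcal{X})=\{\Pi_*P : P\in\mathcal{P}(\mathcal{X})\}$.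
   Context: Standing setting. $G$ is a topological group that is locally compact, Hausdorff, $\sigma$-compact and unimodular; $\lambda$ denotes its Haar measure, a nonzero Borel measure invariant under left and right translations ($\sigma$-finite, possibly of infinite total mass). $\mathcal{X}$ is a Polish space with Borel $\sigma$-algebra $\mathcal{B}(\mathcal{X})$, and $\mathcal{P}(\mathcal{X})$ is the set of Borel probability measures on $\mathcal{X}$. A (left) action of $G$ on $\mathcal{X}$ is a map $\varphi:G\times\mathcal{X}\to\mathcal{X}$, $(g,x)\mapsto\varphi_g(x)$, with $\varphi_e=\mathrm{id}_{\mathcal{X}}$ and $\varphi_{gh}=\varphi_g\circ\varphi_h$; it is assumed jointly measurable with respect to the product $\sigma$-algebra on $G\times\mathcal{X}$. Quotient. The orbit of $x$ is $[x]=\{\varphi_g(x): g\in G\}$, $\mathcal{X}/G$ is the set of orbits, $\Pi(x)=[x]$, and $\mathcal{X}/G$ carries the quotient $\sigma$-algebra $\mathcal{B}(\mathcal{X}/G)=\{A\subseteq\mathcal{X}/G:\Pi^{-1}(A)\in\mathcal{B}(\mathcal{X})\}$. $\Pi_*P$ is the pushforward of $P$ by $\Pi$. Measurability of a kernel on $\mathcal{X}/G$ is with respect to the product $\sigma$-algebra $\mathcal{B}(\mathcal{X}/G)\otimes\mathcal{B}(\mathcal{X}/G)$. Positive definite kernel: a symmetric function $k$ with $\sum_{i,j}a_ia_jk(x_i,x_j)\ge 0$ for all finite families of points $x_i$ and reals $a_i$. $\mathcal{M}^\rho(G)$ is the set of $\sigma$-finite (nonnegative) Borel measures $\nu$ on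 $G$ such that $\sup_{x\in\mathcal{X}}\int_G\rho(\varphi_g(x))\,\mathrm{d}\nu(g)<\infty$. The weighted kernel is $k^\rho(x,y)=\rho(x)k(x,y)\rho(y)$, and the Haar-averaged kernel is $k^\rho_\lambda(x,y)=\int_G\int_G k^\rho(\varphi_g(x),\varphi_h(y))\,\mathrm{d}\lambda(g)\,\mathrm{d}\lambda(h)$. Mean embedding and characteristic kernel. The mean embedding of a measure $\mu$ with respect to a kernel $\kappa$ is $m(\mu)=\int\kappa(\cdot,x)\,\mathrm{d}\mu(x)$, an element of the reproducing kernel Hilbert space of $\kappa$. A kernel is characteristic on a class of measures if $\mu\mapsto m(\mu)$ is injective on that class. *)

theory Defs
  imports "HOL-Probability.Probability"
begin

section \<open>Groups and actions\<close>

text \<open>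
  The group is written additively: \<open>topological_group_add\<close> extends \<open>group_add\<close>, in which
  addition is not assumed to be commutative.
\<close>

definition sigma_compact_space :: "'a::topological_space itself \<Rightarrow> bool" where
  "sigma_compact_space _ \<longleftrightarrow>
     (\<exists>K :: nat \<Rightarrow> 'a set. (\<forall>n. compact (K n)) \<and> (\<Union>n. K n) = UNIV)"

text \<open>
  The Haar measure of a unimodular group: a left Haar measure that is also right invariant, so
  that existence of such a measure is unimodularity. Finiteness on compact sets and regularity
  are not required.
\<close>

definition unimodular_haar_measure :: "'g::topological_group_add measure \<Rightarrow> bool" where
  "unimodular_haar_measure \<eta> \<longleftrightarrow>
     sets \<eta> = sets borel \<and> sigma_finite_measure \<eta> \<and> emeasure \<eta> UNIV \<noteq> 0 \<and>
     (\<forall>g. \<forall>A\<in>sets borel. emeasure \<eta> ((\<lambda>h. g + h) ` A) = emeasure \<eta> A) \<and>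
     (\<forall>g. \<forall>A\<in>sets borel. emeasure \<eta> ((\<lambda>h. h + g) ` A) = emeasure \<eta> A)"

definition measurable_action ::
    "('g::topological_group_add \<Rightarrow> 'x::topological_space \<Rightarrow> 'x) \<Rightarrow> bool" where
  "measurable_action \<phi> \<longleftrightarrow>
     (\<forall>x. \<phi> 0 x = x) \<and> (\<forall>g h x. \<phi> (g + h) x = \<phi> g (\<phi> h x)) \<and>
     (\<lambda>(g, x). \<phi> g x) \<in> borel \<Otimes>\<^sub>M borel \<rightarrow>\<^sub>M borel"

definition orbit :: "('g \<Rightarrow> 'x \<Rightarrow> 'x) \<Rightarrow> 'x \<Rightarrow> 'x set" where
  "orbit \<phi> x = range (\<lambda>g. \<phi> g x)"

text \<open>Only the space and the sigma-algebra of this measure matter.\<close>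

definition orbit_space :: "('g \<Rightarrow> 'x::topological_space \<Rightarrow> 'x) \<Rightarrow> 'x set measure" where
  "orbit_space \<phi> =
     sigma (range (orbit \<phi>)) {A. A \<subseteq> range (orbit \<phi>) \<and> orbit \<phi> -` A \<in> sets borel}"

section \<open>Kernels\<close>

text \<open>
  A kernel on a set \<open>S\<close> is a function whose values outside \<open>S\<close> are irrelevant; this covers both
  \<open>S = UNIV\<close> and the set of orbits. Accordingly, functions on \<open>S\<close> are \<open>extensional\<close>.
\<close>

definition positive_definite_on :: "'a set \<Rightarrow> ('a \<Rightarrow> 'a \<Rightarrow> real) \<Rightarrow> bool" where
  "positive_definite_on S \<kappa> \<longleftrightarrow>
     (\<forall>x\<in>S. \<forall>y\<in>S. \<kappa> x y = \<kappa> y x) \<and>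
     (\<forall>(n::nat) (x :: nat \<Rightarrow> 'a) (a :: nat \<Rightarrow> real). (\<forall>i<n. x i \<in> S) \<longrightarrow>
        0 \<le> (\<Sum>i<n. \<Sum>j<n. a i * a j * \<kappa> (x i) (x j)))"

text \<open>
  Finitely supported coefficient functions \<open>c\<close> encode the elements \<open>\<Sum>x. c x * \<kappa> (\<cdot>, x)\<close> of the
  span of the kernel sections; their squared norm is \<open>\<Sum>x y. c x * c y * \<kappa> (x, y)\<close>.
\<close>

definition kernel_combination :: "('a \<Rightarrow> 'a \<Rightarrow> real) \<Rightarrow> ('a \<Rightarrow> real) \<Rightarrow> 'a \<Rightarrow> real" where
  "kernel_combination \<kappa> c y = (\<Sum>x | c x \<noteq> 0. c x * \<kappa> y x)"

definition kernel_norm2 :: "('a \<Rightarrow> 'a \<Rightarrow> real) \<Rightarrow> ('a \<Rightarrow> real) \<Rightarrow> real" where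
  "kernel_norm2 \<kappa> c = (\<Sum>x | c x \<noteq> 0. \<Sum>y | c y \<noteq> 0. c x * c y * \<kappa> x y)"

text \<open>
  The reproducing kernel Hilbert space as a set of functions (Moore--Aronszajn construction): the
  completion of the span of the kernel sections, where a Cauchy sequence is identified with its
  pointwise limit.
\<close>

definition rkhs :: "'a set \<Rightarrow> ('a \<Rightarrow> 'a \<Rightarrow> real) \<Rightarrow> ('a \<Rightarrow> real) set" where
  "rkhs S \<kappa> = {f \<in> extensional S. \<exists>c :: nat \<Rightarrow> 'a \<Rightarrow> real.
     (\<forall>n. finite {x. c n x \<noteq> 0} \<and> {x. c n x \<noteq> 0} \<subseteq> S) \<and>
     (\<forall>e>0. \<exists>N. \<forall>m\<ge>N. \<forall>n\<ge>N. kernel_norm2 \<kappa> (\<lambda>x. c m x - c n x) < e) \<and>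
     (\<forall>y\<in>S. (\<lambda>n. kernel_combination \<kappa> (c n) y) \<longlonglongrightarrow> f y)}"

text \<open>
  The integral of \<open>\<kappa> (\<cdot>, x)\<close> is given by its values: evaluation at \<open>y\<close> is a continuous linear
  functional on the reproducing kernel Hilbert space and so commutes with the integral.
  That the function obtained lies in that space is part of \<open>characteristic_on\<close> below.
\<close>

definition mean_embedding :: "('a \<Rightarrow> 'a \<Rightarrow> real) \<Rightarrow> 'a measure \<Rightarrow> 'a \<Rightarrow> real" where
  "mean_embedding \<kappa> \<mu> = (\<lambda>y\<in>space \<mu>. \<integral>x. \<kappa> y x \<partial>\<mu>)"

definition characteristic_on ::
    "'a set \<Rightarrow> ('a \<Rightarrow> 'a \<Rightarrow> real) \<Rightarrow> 'a measure set \<Rightarrow> bool" where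
  "characteristic_on S \<kappa> C \<longleftrightarrow>
     (\<forall>\<mu>\<in>C. mean_embedding \<kappa> \<mu> \<in> rkhs S \<kappa>) \<and> inj_on (mean_embedding \<kappa>) C"

section \<open>Finite signed measures\<close>

text \<open>
  The value 0 outside the Borel sets makes equality of signed measures equality of functions.
\<close>

definition finite_signed_measures :: "('a::topological_space set \<Rightarrow> real) set" where
  "finite_signed_measures = {\<nu>. (\<forall>A. A \<notin> sets borel \<longrightarrow> \<nu> A = 0) \<and>
     (\<forall>A :: nat \<Rightarrow> 'a set. range A \<subseteq> sets borel \<longrightarrow> disjoint_family A \<longrightarrow>
        (\<lambda>i. \<nu> (A i)) sums \<nu> (\<Union>i. A i))}"

text \<open>
  Upper variation of the Jordan decomposition; \<open>ennreal\<close> truncates negative values to 0, which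
  does not affect the supremum because the empty set is among the competitors.
\<close>

definition positive_variation :: "('a::topological_space set \<Rightarrow> real) \<Rightarrow> 'a measure" where
  "positive_variation \<nu> =
     measure_of UNIV (sets borel) (\<lambda>A. SUP B\<in>{B \<in> sets borel. B \<subseteq> A}. ennreal (\<nu> B))"

definition signed_integral ::
    "('a::topological_space set \<Rightarrow> real) \<Rightarrow> ('a \<Rightarrow> real) \<Rightarrow> real" where
  "signed_integral \<nu> f =
     (\<integral>x. f x \<partial>positive_variation \<nu>) - (\<integral>x. f x \<partial>positive_variation (\<lambda>A. - \<nu> A))"

definition signed_mean_embedding ::
    "('a \<Rightarrow> 'a \<Rightarrow> real) \<Rightarrow> ('a::topological_space set \<Rightarrow> real) \<Rightarrow> 'a \<Rightarrow> real" where
  "signed_mean_embedding \<kappa> \<nu> = (\<lambda>y. signed_integral \<nu> (\<lambda>x. \<kappa> y x))"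

definition characteristic_on_signed ::
    "('a \<Rightarrow> 'a \<Rightarrow> real) \<Rightarrow> ('a::topological_space set \<Rightarrow> real) set \<Rightarrow> bool" where
  "characteristic_on_signed \<kappa> C \<longleftrightarrow>
     (\<forall>\<nu>\<in>C. signed_mean_embedding \<kappa> \<nu> \<in> rkhs UNIV \<kappa>) \<and>
     inj_on (signed_mean_embedding \<kappa>) C"

section \<open>Weighted and averaged kernels\<close>

definition weighted_measures ::
    "('g::topological_space \<Rightarrow> 'x \<Rightarrow> 'x) \<Rightarrow> ('x \<Rightarrow> real) \<Rightarrow> 'g measure set" where
  "weighted_measures \<phi> \<rho> = {\<nu>. sets \<nu> = sets borel \<and> sigma_finite_measure \<nu> \<and>
     (SUP x. \<integral>\<^sup>+g. ennreal (\<rho> (\<phi> g x)) \<partial>\<nu>) < \<infinity>}"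

definition weighted_kernel :: "('x \<Rightarrow> real) \<Rightarrow> ('x \<Rightarrow> 'x \<Rightarrow> real) \<Rightarrow> 'x \<Rightarrow> 'x \<Rightarrow> real" where
  "weighted_kernel \<rho> k x y = \<rho> x * k x y * \<rho> y"

definition averaged_kernel ::
    "('g \<Rightarrow> 'x \<Rightarrow> 'x) \<Rightarrow> 'g measure \<Rightarrow> ('x \<Rightarrow> 'x \<Rightarrow> real) \<Rightarrow> 'x \<Rightarrow> 'x \<Rightarrow> real" where
  "averaged_kernel \<phi> \<eta> \<kappa> x y = (\<integral>h. (\<integral>g. \<kappa> (\<phi> g x) (\<phi> h y) \<partial>\<eta>) \<partial>\<eta>)"

end

theory Submission
  imports Defs
begin

text \<open>
  A continuous positive definite kernel on a separable space has a countable expansion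
  \<open>k x y = (\<Sum>n. e n x * e n y)\<close> into continuous features. Integrating \<open>\<rho> * e n\<close> along orbits gives
  invariant features of the averaged kernel, hence features on the orbit space; measurability,
  positive definiteness and membership of mean embeddings in the reproducing kernel Hilbert space
  follow from the expansion. If two laws on the orbit space have the same mean embedding, the
  features have equal integrals, so that the finite measures \<open>\<integral>\<integral> 1\<^sub>A(\<phi> g x) \<rho>(\<phi> g x) d\<eta>(g) dP(x)\<close>
  have the same mean embedding under \<open>k\<close> and coincide. For invariant \<open>A\<close> this measure is
  \<open>\<integral>\<^sub>A w dP\<close> with \<open>w x = \<integral> \<rho>(\<phi> g x) d\<eta>(g)\<close> invariant, positive and finite, so that dividing by \<open>w\<close>
  recovers \<open>P A\<close>.
\<close>

section \<open>Countable expansions of continuous kernels\<close>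

lemma positive_definite_onD:
  fixes n :: nat
  assumes "positive_definite_on S \<kappa>" "\<And>i. i < n \<Longrightarrow> x i \<in> S"
  shows "0 \<le> (\<Sum>i<n. \<Sum>j<n. a i * a j * \<kappa> (x i) (x j))"
proof -
  have "(\<forall>i<n. x i \<in> S) \<longrightarrow> 0 \<le> (\<Sum>i<n. \<Sum>j<n. a i * a j * \<kappa> (x i) (x j))"
    using assms(1) unfolding positive_definite_on_def by meson
  then show ?thesis using assms(2) by simp
qed

lemma positive_definite_on_sym:
  "positive_definite_on S \<kappa> \<Longrightarrow> x \<in> S \<Longrightarrow> y \<in> S \<Longrightarrow> \<kappa> x y = \<kappa> y x"
  unfolding positive_definite_on_def by blast

lemma positive_definite_on_diag_nonneg:
  assumes "positive_definite_on S \<kappa>" "x \<in> S"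
  shows "0 \<le> \<kappa> x x"
  using positive_definite_onD[OF assms(1), of "Suc 0" "\<lambda>_. x" "\<lambda>_. 1"] assms(2) by simp

text \<open>Adjoin \<open>d\<close> with coefficient \<open>- t\<close> to the family. The form
  becomes a quadratic polynomial in \<open>t\<close>, and suitable values of \<open>t\<close> yield
  Cauchy-Schwarz and the Schur complement.\<close>

lemma positive_definite_on_extend:
  fixes n :: nat
  assumes pd: "positive_definite_on S \<kappa>" and x: "\<And>i. i < n \<Longrightarrow> x i \<in> S" and d: "d \<in> S"
  shows "0 \<le> (\<Sum>i<n. \<Sum>j<n. a i * a j * \<kappa> (x i) (x j))
             - 2 * t * (\<Sum>i<n. a i * \<kappa> (x i) d) + t\<^sup>2 * \<kappa> d d"
proof -
  have "0 \<le> (\<Sum>i<Suc n. \<Sum>j<Suc n. (a(n := - t)) i * (a(n := - t)) j * \<kappa> ((x(n := d)) i) ((x(n := d)) j))"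
    using x d by (intro positive_definite_onD[OF pd]) (auto simp: less_Suc_eq)
  also have "\<dots> = (\<Sum>i<n. (\<Sum>j<n. a i * a j * \<kappa> (x i) (x j)) - t * (a i * \<kappa> (x i) d))
      + ((\<Sum>j<n. - t * (a j * \<kappa> d (x j))) + t\<^sup>2 * \<kappa> d d)"
    by (simp add: power2_eq_square algebra_simps)
  also have "(\<Sum>j<n. - t * (a j * \<kappa> d (x j))) = - t * (\<Sum>i<n. a i * \<kappa> (x i) d)"
    unfolding sum_distrib_left
    by (intro sum.cong refl) (use positive_definite_on_sym[OF pd d] x in auto)
  finally show ?thesis
    unfolding sum_subtractf sum_distrib_left[symmetric] by simp
qed

lemma positive_definite_on_Cauchy_Schwarz:
  assumes pd: "positive_definite_on S \<kappa>" and "x \<in> S" "y \<in> S"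
  shows "(\<kappa> x y)\<^sup>2 \<le> \<kappa> x x * \<kappa> y y"
proof -
  have ext: "0 \<le> a\<^sup>2 * \<kappa> x x - 2 * t * (a * \<kappa> x y) + t\<^sup>2 * \<kappa> y y" for a t
    using positive_definite_on_extend[OF pd, of "Suc 0" "\<lambda>_. x" y "\<lambda>_. a" t] assms(2,3)
    by (simp add: power2_eq_square)
  show ?thesis
  proof (cases "\<kappa> y y = 0")
    case True
    show ?thesis
    proof (rule ccontr)
      assume "\<not> ?thesis"
      then have nz: "\<kappa> x y \<noteq> 0" using True by auto
      \<comment> \<open>With \<open>\<kappa> y y = 0\<close> and coefficient 1 at \<open>x\<close>
        the form is affine in \<open>t\<close>; this \<open>t\<close> gives it the value -1.\<close>
      have "0 \<le> \<kappa> x x - 2 * ((\<kappa> x x + 1) / (2 * \<kappa> x y)) * \<kappa> x y"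
        using ext[of 1 "(\<kappa> x x + 1) / (2 * \<kappa> x y)"] True by simp
      then show False using nz by simp
    qed
  next
    case False
    then have pos: "\<kappa> y y > 0"
      using positive_definite_on_diag_nonneg[OF pd assms(3)] by simp
    \<comment> \<open>The optimal ratio of \<open>t\<close> to \<open>a\<close> is
      \<open>\<kappa> x y / \<kappa> y y\<close>; taking numerator and denominator as
      \<open>t\<close> and \<open>a\<close> avoids the division.\<close>
    have "0 \<le> \<kappa> y y * (\<kappa> x x * \<kappa> y y - (\<kappa> x y)\<^sup>2)"
      using ext[of "\<kappa> y y" "\<kappa> x y"] by (simp add: power2_eq_square algebra_simps)
    then show ?thesis using pos by (simp add: zero_le_mult_iff)
  qed
qed

lemma positive_definite_on_diag_eq_0D:
  assumes "positive_definite_on S \<kappa>" "x \<in> S" "y \<in> S" "\<kappa> x x = 0"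
  shows "\<kappa> x y = 0"
  using positive_definite_on_Cauchy_Schwarz[OF assms(1-3)] assms(4) by simp

text \<open>For \<open>\<kappa> d d > 0\<close> the new form is the minimum over \<open>t\<close> of
  the form extended by \<open>d\<close>, attained at \<open>t = L / \<kappa> d d\<close>. For
  \<open>\<kappa> d d = 0\<close> division by zero returns 0, so nothing is subtracted.\<close>

lemma positive_definite_on_Schur_complement:
  assumes pd: "positive_definite_on S \<kappa>" and d: "d \<in> S"
  shows "positive_definite_on S (\<lambda>x y. \<kappa> x y - \<kappa> x d * \<kappa> d y / \<kappa> d d)"
  unfolding positive_definite_on_def
proof (intro conjI ballI allI impI)
  fix x y assume "x \<in> S" "y \<in> S"
  then show "\<kappa> x y - \<kappa> x d * \<kappa> d y / \<kappa> d d = \<kappa> y x - \<kappa> y d * \<kappa> d x / \<kappa> d d"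
    using positive_definite_on_sym[OF pd] d by (metis mult.commute)
next
  fix n and x :: "nat \<Rightarrow> 'a" and a :: "nat \<Rightarrow> real"
  assume "\<forall>i<n. x i \<in> S"
  then have x: "\<And>i. i < n \<Longrightarrow> x i \<in> S" by blast
  define L where "L = (\<Sum>i<n. a i * \<kappa> (x i) d)"
  have "(\<Sum>i<n. \<Sum>j<n. a i * a j * (\<kappa> (x i) d * \<kappa> d (x j) / \<kappa> d d)) = L * L / \<kappa> d d"
    unfolding L_def sum_product sum_divide_distrib
    by (intro sum.cong refl) (use positive_definite_on_sym[OF pd d] x in \<open>auto simp: algebra_simps\<close>)
  moreover have "0 \<le> (\<Sum>i<n. \<Sum>j<n. a i * a j * \<kappa> (x i) (x j)) - L * L / \<kappa> d d"
    using positive_definite_on_extend[of S \<kappa> n x d a "L / \<kappa> d d", OF pd x d]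
    by (cases "\<kappa> d d = 0") (auto simp: L_def[symmetric] power2_eq_square)
  ultimately show "0 \<le> (\<Sum>i<n. \<Sum>j<n. a i * a j * (\<kappa> (x i) (x j) - \<kappa> (x i) d * \<kappa> d (x j) / \<kappa> d d))"
    by (simp add: right_diff_distrib sum_subtractf)
qed

section \<open>Cholesky elimination along a sequence of pivots\<close>

fun residual_kernel :: "('a \<Rightarrow> 'a \<Rightarrow> real) \<Rightarrow> (nat \<Rightarrow> 'a) \<Rightarrow> nat \<Rightarrow> 'a \<Rightarrow> 'a \<Rightarrow> real" where
  "residual_kernel k d 0 = k"
| "residual_kernel k d (Suc n) = (\<lambda>x y. residual_kernel k d n x y
     - residual_kernel k d n x (d n) * residual_kernel k d n (d n) y / residual_kernel k d n (d n) (d n))"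

text \<open>The \<open>n\<close>-th column of the Cholesky factor. A pivot whose residual is already
  zero yields the zero feature, because division by zero returns 0.\<close>

definition pivot_feature :: "('a \<Rightarrow> 'a \<Rightarrow> real) \<Rightarrow> (nat \<Rightarrow> 'a) \<Rightarrow> nat \<Rightarrow> 'a \<Rightarrow> real" where
  "pivot_feature k d n x = residual_kernel k d n x (d n) / sqrt (residual_kernel k d n (d n) (d n))"

lemma positive_definite_residual_kernel:
  "positive_definite_on UNIV k \<Longrightarrow> positive_definite_on UNIV (residual_kernel k d n)"
  by (induction n) (auto intro: positive_definite_on_Schur_complement)

text \<open>Eliminating a pivot clears its row, and later Schur complements keep a zero row zero. A
  pivot with vanishing diagonal has a zero row already, by Cauchy-Schwarz.\<close>

lemma residual_kernel_pivot_eq_0: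
  assumes pd: "positive_definite_on UNIV k" and "m < n"
  shows "residual_kernel k d n (d m) y = 0"
  using \<open>m < n\<close>
proof (induction n arbitrary: y)
  case (Suc n)
  have "residual_kernel k d n (d n) (d n) = 0 \<Longrightarrow> residual_kernel k d n (d n) y = 0"
    using positive_definite_on_diag_eq_0D[OF positive_definite_residual_kernel[OF pd]] by simp
  then show ?case using Suc by (cases "m = n") auto
qed simp

text \<open>Each elimination step subtracts exactly the product of the two values of the pivot
  feature, so the sum telescopes.\<close>

lemma residual_kernel_eq:
  assumes pd: "positive_definite_on UNIV k"
  shows "k x y = (\<Sum>i<n. pivot_feature k d i x * pivot_feature k d i y) + residual_kernel k d n x y"
proof (induction n)
  case (Suc n)
  note pdn = positive_definite_residual_kernel[OF pd]
  have "pivot_feature k d n x * pivot_feature k d n y =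
      residual_kernel k d n x (d n) * residual_kernel k d n (d n) y / residual_kernel k d n (d n) (d n)"
    using positive_definite_on_diag_nonneg[OF pdn, of "d n" d n]
      positive_definite_on_sym[OF pdn, of y "d n" d n]
    by (simp add: pivot_feature_def)
  then show ?case using Suc by simp
qed simp

lemma continuous_on_residual_kernel:
  fixes k :: "'a::topological_space \<Rightarrow> 'a \<Rightarrow> real"
  assumes "continuous_on UNIV (\<lambda>(x, y). k x y)"
  shows "continuous_on UNIV (\<lambda>(x, y). residual_kernel k d n x y)"
proof (induction n)
  case (Suc n)
  have "continuous_on UNIV (\<lambda>z. residual_kernel k d n (f z) (g z))"
    if "continuous_on UNIV f" "continuous_on UNIV g" for f g :: "'a \<times> 'a \<Rightarrow> 'a"
    using continuous_on_compose2[OF Suc continuous_on_Pair[OF that]] by simp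
  note this[continuous_intros]
  show ?case
    unfolding residual_kernel.simps case_prod_beta divide_inverse by (intro continuous_intros)
qed (use assms in simp)

lemma continuous_on_pivot_feature:
  fixes k :: "'a::topological_space \<Rightarrow> 'a \<Rightarrow> real"
  assumes "continuous_on UNIV (\<lambda>(x, y). k x y)"
  shows "continuous_on UNIV (pivot_feature k d n)"
proof -
  have "continuous_on UNIV (\<lambda>x. residual_kernel k d n x (d n))"
    using continuous_on_compose2[OF continuous_on_residual_kernel[OF assms, of d n],
        of UNIV "\<lambda>x. (x, d n)"] by (simp add: continuous_on_Pair continuous_on_id continuous_on_const)
  then show ?thesis
    unfolding pivot_feature_def divide_inverse by (intro continuous_on_mult_right)
qed

text \<open>The right side minus the left is the squared distance between the first \<open>n\<close>
  features of \<open>x\<close> and of \<open>d m\<close>, because the residual vanishes at the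
  earlier pivot \<open>d m\<close>.\<close>

lemma residual_kernel_diag_le:
  assumes pd: "positive_definite_on UNIV k" and "m < n"
  shows "residual_kernel k d n x x \<le> k x x - 2 * k x (d m) + k (d m) (d m)"
proof -
  let ?e = "pivot_feature k d"
  have "residual_kernel k d n (d m) z = 0" for z
    using residual_kernel_pivot_eq_0[OF assms] .
  moreover from this have "residual_kernel k d n x (d m) = 0"
    using positive_definite_on_sym[OF positive_definite_residual_kernel[OF pd]] by simp
  ultimately have "k x x - 2 * k x (d m) + k (d m) (d m) - residual_kernel k d n x x =
      (\<Sum>i<n. (?e i x - ?e i (d m))\<^sup>2)"
    by (simp add: residual_kernel_eq[OF pd, of _ _ d n] power2_diff power2_eq_square
        sum.distrib sum_subtractf sum_distrib_left algebra_simps)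
  moreover have "0 \<le> (\<Sum>i<n. (?e i x - ?e i (d m))\<^sup>2)"
    by (intro sum_nonneg) simp
  ultimately show ?thesis by simp
qed

text \<open>
  A pivoted Cholesky decomposition along a dense sequence: the residual vanishes at all earlier
  pivots, and its diagonal at \<open>x\<close> is at most the squared kernel distance from \<open>x\<close> to any of them.
\<close>

lemma positive_definite_continuous_expansion:
  fixes k :: "'a::second_countable_topology \<Rightarrow> 'a \<Rightarrow> real"
  assumes cont: "continuous_on UNIV (\<lambda>(x, y). k x y)" and pd: "positive_definite_on UNIV k"
  obtains e :: "nat \<Rightarrow> 'a \<Rightarrow> real" where
    "\<And>n. continuous_on UNIV (e n)" "\<And>x y. (\<lambda>n. e n x * e n y) sums k x y"
proof -
  obtain D :: "'a set" where D: "countable D" "\<And>X. open X \<Longrightarrow> X \<noteq> {} \<Longrightarrow> \<exists>d\<in>D. d \<in> X"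
    using countable_dense_exists by blast
  define d where "d = from_nat_into D"
  have "D \<noteq> {}" using D(2)[of UNIV] by auto
  then have range_d: "range d = D" unfolding d_def by (rule range_from_nat_into) (rule D)
  have diag: "(\<lambda>n. residual_kernel k d n x x) \<longlonglongrightarrow> 0" for x
  proof (rule LIMSEQ_I)
    fix r :: real assume "0 < r"
    \<comment> \<open>The squared kernel distance from \<open>x\<close> is continuous and zero at
      \<open>x\<close>, so the dense sequence meets the open set where it is below
      \<open>r\<close>.\<close>
    define \<delta> where "\<delta> z = k x x - 2 * k x z + k z z" for z
    have "continuous_on UNIV (\<lambda>z. k (f z) (g z))"
      if "continuous_on UNIV f" "continuous_on UNIV g" for f g :: "'a \<Rightarrow> 'a"
      using continuous_on_compose2[OF cont continuous_on_Pair[OF that]] by simp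
    note this[continuous_intros]
    have "continuous_on UNIV \<delta>"
      unfolding \<delta>_def by (intro continuous_intros)
    then have "open {z. \<delta> z < r}"
      by (intro open_Collect_less continuous_on_const)
    moreover have "x \<in> {z. \<delta> z < r}" using \<open>0 < r\<close> by (simp add: \<delta>_def)
    ultimately obtain m where m: "\<delta> (d m) < r"
      using D(2) range_d by (metis (no_types, lifting) empty_iff imageE mem_Collect_eq)
    have "norm (residual_kernel k d n x x - 0) < r" if "n \<ge> Suc m" for n
      using residual_kernel_diag_le[OF pd, of m n d x] that m
        positive_definite_on_diag_nonneg[OF positive_definite_residual_kernel[OF pd], of x d n]
      by (simp add: \<delta>_def)
    then show "\<exists>no. \<forall>n\<ge>no. norm (residual_kernel k d n x x - 0) < r" by blast
  qed
  \<comment> \<open>Off the diagonal, Cauchy-Schwarz for the residual reduces the claim to the two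
    diagonal limits.\<close>
  have "(\<lambda>n. residual_kernel k d n x y) \<longlonglongrightarrow> 0" for x y
  proof (rule tendsto_rabs_zero_cancel, rule tendsto_sandwich[where f = "\<lambda>_. 0"])
    note pdn = positive_definite_residual_kernel[OF pd]
    show "\<forall>\<^sub>F n in sequentially. \<bar>residual_kernel k d n x y\<bar> \<le>
        sqrt (residual_kernel k d n x x * residual_kernel k d n y y)"
      using positive_definite_on_Cauchy_Schwarz[OF pdn]
      by (auto intro!: always_eventually real_le_rsqrt)
    show "(\<lambda>n. sqrt (residual_kernel k d n x x * residual_kernel k d n y y)) \<longlonglongrightarrow> 0"
      using tendsto_real_sqrt[OF tendsto_mult[OF diag[of x] diag[of y]]] by simp
  qed auto
  then have "(\<lambda>n. k x y - residual_kernel k d n x y) \<longlonglongrightarrow> k x y - 0" for x y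
    by (intro tendsto_diff tendsto_const)
  moreover have "k x y - residual_kernel k d n x y =
      (\<Sum>i<n. pivot_feature k d i x * pivot_feature k d i y)" for x y n
    using residual_kernel_eq[OF pd, of x y d n] by simp
  ultimately have "(\<lambda>n. pivot_feature k d n x * pivot_feature k d n y) sums k x y" for x y
    by (simp add: sums_def)
  then show thesis
    using that continuous_on_pivot_feature[OF cont] by blast
qed

section \<open>Termwise integration and square-summable sequences\<close>

lemma sums_integral_dominated:
  fixes f :: "nat \<Rightarrow> 'a \<Rightarrow> real"
  assumes f: "\<And>n. integrable M (f n)" and D: "integrable M D"
    and sums: "\<And>x. x \<in> space M \<Longrightarrow> (\<lambda>n. f n x) sums F x"
    and bound: "\<And>n x. x \<in> space M \<Longrightarrow> \<bar>\<Sum>i<n. f i x\<bar> \<le> D x"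
  shows "(\<lambda>n. \<integral>x. f n x \<partial>M) sums (\<integral>x. F x \<partial>M)"
proof -
  have meas: "(\<lambda>x. \<Sum>i<n. f i x) \<in> borel_measurable M" for n
    using f by (intro borel_measurable_sum) auto
  have lim: "(\<lambda>n. \<Sum>i<n. f i x) \<longlonglongrightarrow> F x" if "x \<in> space M" for x
    using sums[OF that] by (simp add: sums_def)
  have "(\<lambda>n. \<integral>x. (\<Sum>i<n. f i x) \<partial>M) \<longlonglongrightarrow> (\<integral>x. F x \<partial>M)"
  proof (rule integral_dominated_convergence[OF _ meas D])
    show "F \<in> borel_measurable M" by (rule borel_measurable_LIMSEQ_metric[OF meas lim])
  qed (use lim bound in auto)
  moreover have "(\<integral>x. (\<Sum>i<n. f i x) \<partial>M) = (\<Sum>i<n. \<integral>x. f i x \<partial>M)" for n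
    using f by (intro Bochner_Integration.integral_sum) auto
  ultimately show ?thesis by (simp add: sums_def)
qed

lemma abs_sum_mult_le_half_sum_squares:
  fixes u v :: "'i \<Rightarrow> real"
  shows "\<bar>\<Sum>i\<in>I. u i * v i\<bar> \<le> ((\<Sum>i\<in>I. (u i)\<^sup>2) + (\<Sum>i\<in>I. (v i)\<^sup>2)) / 2"
proof -
  have "\<bar>u i * v i\<bar> \<le> ((u i)\<^sup>2 + (v i)\<^sup>2) / 2" for i
    using sum_squares_bound[of "\<bar>u i\<bar>" "\<bar>v i\<bar>"] by (simp add: abs_mult)
  then have "(\<Sum>i\<in>I. \<bar>u i * v i\<bar>) \<le> (\<Sum>i\<in>I. ((u i)\<^sup>2 + (v i)\<^sup>2) / 2)"
    by (intro sum_mono)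
  also have "\<dots> = ((\<Sum>i\<in>I. (u i)\<^sup>2) + (\<Sum>i\<in>I. (v i)\<^sup>2)) / 2"
    by (simp add: sum_divide_distrib[symmetric] sum.distrib)
  finally show ?thesis by (rule order_trans[OF sum_abs])
qed

lemma summable_mult_of_summable_squares:
  fixes u v :: "nat \<Rightarrow> real"
  assumes "summable (\<lambda>n. (u n)\<^sup>2)" "summable (\<lambda>n. (v n)\<^sup>2)"
  shows "summable (\<lambda>n. u n * v n)"
proof (rule summable_comparison_test'[of "\<lambda>n. ((u n)\<^sup>2 + (v n)\<^sup>2) / 2" 0])
  show "summable (\<lambda>n. ((u n)\<^sup>2 + (v n)\<^sup>2) / 2)"
    using assms by (intro summable_divide summable_add)
  show "norm (u n * v n) \<le> ((u n)\<^sup>2 + (v n)\<^sup>2) / 2" for n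
    using sum_squares_bound[of "\<bar>u n\<bar>" "\<bar>v n\<bar>"] by (simp add: abs_mult)
qed

lemma summable_square_add:
  fixes u v :: "nat \<Rightarrow> real"
  assumes "summable (\<lambda>n. (u n)\<^sup>2)" "summable (\<lambda>n. (v n)\<^sup>2)"
  shows "summable (\<lambda>n. (u n + v n)\<^sup>2)"
proof -
  have "summable (\<lambda>n. (u n)\<^sup>2 + (v n)\<^sup>2 + 2 * (u n * v n))"
    using assms summable_mult_of_summable_squares[OF assms] by (intro summable_add summable_mult)
  then show ?thesis by (simp add: power2_sum mult.assoc)
qed

lemma summable_square_scale:
  fixes u :: "nat \<Rightarrow> real"
  shows "summable (\<lambda>n. (u n)\<^sup>2) \<Longrightarrow> summable (\<lambda>n. (c * u n)\<^sup>2)"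
  by (simp add: power_mult_distrib summable_mult)

lemma summable_square_diff:
  fixes u v :: "nat \<Rightarrow> real"
  assumes "summable (\<lambda>n. (u n)\<^sup>2)" "summable (\<lambda>n. (v n)\<^sup>2)"
  shows "summable (\<lambda>n. (u n - v n)\<^sup>2)"
  using summable_square_add[OF assms(1) summable_square_scale[OF assms(2), of "-1"]] by simp

lemma Cauchy_Schwarz_suminf:
  fixes u v :: "nat \<Rightarrow> real"
  assumes "summable (\<lambda>n. (u n)\<^sup>2)" "summable (\<lambda>n. (v n)\<^sup>2)"
  shows "(\<Sum>n. u n * v n)\<^sup>2 \<le> (\<Sum>n. (u n)\<^sup>2) * (\<Sum>n. (v n)\<^sup>2)"
proof (rule LIMSEQ_le)
  show "(\<lambda>N. (\<Sum>n<N. u n * v n)\<^sup>2) \<longlonglongrightarrow> (\<Sum>n. u n * v n)\<^sup>2"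
    by (intro tendsto_power summable_LIMSEQ summable_mult_of_summable_squares assms)
  show "(\<lambda>N. (\<Sum>n<N. (u n)\<^sup>2) * (\<Sum>n<N. (v n)\<^sup>2)) \<longlonglongrightarrow> (\<Sum>n. (u n)\<^sup>2) * (\<Sum>n. (v n)\<^sup>2)"
    by (intro tendsto_mult summable_LIMSEQ assms)
qed (use Cauchy_Schwarz_ineq_sum in blast)

lemma summable_squares_if_bounded:
  fixes u :: "nat \<Rightarrow> real"
  assumes "\<And>N. (\<Sum>n<N. (u n)\<^sup>2) \<le> K"
  shows "summable (\<lambda>n. (u n)\<^sup>2)"
  by (rule summableI_nonneg_bounded[of _ K]) (use assms in auto)

section \<open>Kernels with bounded feature expansions\<close>

text \<open>A measurable feature map into l2 with squared norm at most \<open>K\<close>; \<kappa> is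
  the inner product of features. \<open>M\<close> supplies only a space and a sigma-algebra, so that
  both the original space and the orbit space are instances.\<close>

locale bounded_features =
  fixes M :: "'a measure" and F :: "nat \<Rightarrow> 'a \<Rightarrow> real" and \<kappa> :: "'a \<Rightarrow> 'a \<Rightarrow> real" and K :: real
  assumes features_measurable: "\<And>n. F n \<in> borel_measurable M"
    and features_sums: "\<And>x y. x \<in> space M \<Longrightarrow> y \<in> space M \<Longrightarrow> (\<lambda>n. F n x * F n y) sums \<kappa> x y"
    and diag_bound: "\<And>x. x \<in> space M \<Longrightarrow> \<kappa> x x \<le> K"
begin

lemma features_square_summable: "x \<in> space M \<Longrightarrow> summable (\<lambda>n. (F n x)\<^sup>2)"
  using features_sums[of x x] by (simp add: power2_eq_square sums_iff)

lemma features_square_suminf: "x \<in> space M \<Longrightarrow> (\<Sum>n. (F n x)\<^sup>2) = \<kappa> x x"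
  using features_sums[of x x] by (simp add: power2_eq_square sums_iff)

lemma features_square_sum_le: "x \<in> space M \<Longrightarrow> (\<Sum>n<N. (F n x)\<^sup>2) \<le> K"
  using sum_le_suminf[OF features_square_summable, of x "{..<N}"] features_square_suminf[of x]
    diag_bound[of x] by simp

text \<open>A countable expansion makes the kernel a pointwise limit of finite sums of products,
  which are measurable for the product sigma-algebra.\<close>

lemma kernel_measurable: "(\<lambda>(x, y). \<kappa> x y) \<in> borel_measurable (M \<Otimes>\<^sub>M M)"
proof (rule borel_measurable_LIMSEQ_metric)
  note features_measurable[measurable]
  show "(\<lambda>z. \<Sum>n<N. F n (fst z) * F n (snd z)) \<in> borel_measurable (M \<Otimes>\<^sub>M M)" for N
    by measurable
  show "(\<lambda>N. \<Sum>n<N. F n (fst z) * F n (snd z)) \<longlonglongrightarrow> (case z of (x, y) \<Rightarrow> \<kappa> x y)"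
    if "z \<in> space (M \<Otimes>\<^sub>M M)" for z
    using features_sums[of "fst z" "snd z"] that
    by (auto simp: sums_def space_pair_measure)
qed

text \<open>The quadratic form is the squared l2 norm of the corresponding combination of feature
  vectors. This gives positive definiteness and identifies \<open>kernel_norm2\<close>.\<close>

lemma kernel_form_sums:
  assumes "finite I" "\<And>i. i \<in> I \<Longrightarrow> x i \<in> space M"
  shows "(\<lambda>n. (\<Sum>i\<in>I. a i * F n (x i))\<^sup>2) sums (\<Sum>i\<in>I. \<Sum>j\<in>I. a i * a j * \<kappa> (x i) (x j))"
proof -
  have "(\<lambda>n. \<Sum>i\<in>I. \<Sum>j\<in>I. a i * a j * (F n (x i) * F n (x j)))
      sums (\<Sum>i\<in>I. \<Sum>j\<in>I. a i * a j * \<kappa> (x i) (x j))"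
    using assms by (intro sums_sum sums_mult features_sums) auto
  then show ?thesis
    by (simp add: power2_eq_square sum_product algebra_simps)
qed

lemma positive_definite: "positive_definite_on (space M) \<kappa>"
  unfolding positive_definite_on_def
proof (intro conjI ballI allI impI)
  fix x y assume "x \<in> space M" "y \<in> space M"
  then show "\<kappa> x y = \<kappa> y x"
    using features_sums[of x y] features_sums[of y x] by (simp add: mult.commute sums_iff)
next
  fix n :: nat and x :: "nat \<Rightarrow> 'a" and a :: "nat \<Rightarrow> real"
  assume "\<forall>i<n. x i \<in> space M"
  then have "(\<lambda>m. (\<Sum>i<n. a i * F m (x i))\<^sup>2) sums (\<Sum>i<n. \<Sum>j<n. a i * a j * \<kappa> (x i) (x j))"
    by (intro kernel_form_sums) auto
  then show "0 \<le> (\<Sum>i<n. \<Sum>j<n. a i * a j * \<kappa> (x i) (x j))"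
    using suminf_nonneg by (fastforce simp: sums_iff)
qed

lemma feature_sum_bound:
  assumes "x \<in> space M" "y \<in> space M"
  shows "\<bar>\<Sum>n<N. F n x * F n y\<bar> \<le> K"
  by (rule order_trans[OF abs_sum_mult_le_half_sum_squares])
    (use features_square_sum_le[OF assms(1), of N] features_square_sum_le[OF assms(2), of N] in simp)

lemma feature_abs_le:
  assumes "x \<in> space M"
  shows "\<bar>F n x\<bar> \<le> sqrt K"
proof (rule real_le_rsqrt)
  have "(F n x)\<^sup>2 \<le> (\<Sum>i<Suc n. (F i x)\<^sup>2)" by (simp add: sum_nonneg)
  then show "\<bar>F n x\<bar>\<^sup>2 \<le> K" using features_square_sum_le[OF assms, of "Suc n"] by simp
qed

section \<open>Integrals of features against a finite measure\<close>

context
  fixes \<mu> :: "'a measure"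
  assumes finite_\<mu>: "finite_measure \<mu>" and sets_\<mu>: "sets \<mu> = sets M"
begin

interpretation finite_measure \<mu> by (rule finite_\<mu>)

lemma features_integrable: "integrable \<mu> (F n)"
proof (rule integrable_const_bound[of _ "sqrt K"])
  show "AE x in \<mu>. norm (F n x) \<le> sqrt K"
    using feature_abs_le sets_eq_imp_space_eq[OF sets_\<mu>] by (intro AE_I2) simp
  show "F n \<in> borel_measurable \<mu>"
    using features_measurable measurable_cong_sets[OF sets_\<mu> refl] by blast
qed

lemma feature_series_bound:
  assumes s: "summable (\<lambda>n. (s n)\<^sup>2)" and x: "x \<in> space M"
  shows "\<bar>\<Sum>i<n. s i * F i x\<bar> \<le> ((\<Sum>n. (s n)\<^sup>2) + K) / 2"
  by (rule order_trans[OF abs_sum_mult_le_half_sum_squares])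
    (use sum_le_suminf[OF s, of "{..<n}"] features_square_sum_le[OF x, of n] in simp)

lemma feature_series_summable:
  assumes s: "summable (\<lambda>n. (s n)\<^sup>2)" and x: "x \<in> space M"
  shows "summable (\<lambda>n. s n * F n x)"
  by (intro summable_mult_of_summable_squares s features_square_summable x)

lemma integrable_feature_series:
  assumes s: "summable (\<lambda>n. (s n)\<^sup>2)"
  shows "integrable \<mu> (\<lambda>x. \<Sum>n. s n * F n x)"
proof (rule integrable_const_bound)
  have sp: "space \<mu> = space M" by (rule sets_eq_imp_space_eq[OF sets_\<mu>])
  have "\<bar>\<Sum>n. s n * F n x\<bar> \<le> ((\<Sum>n. (s n)\<^sup>2) + K) / 2" if "x \<in> space M" for x
    using tendsto_rabs[OF summable_LIMSEQ[OF feature_series_summable[OF s that]]]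
      feature_series_bound[OF s that] by (intro LIMSEQ_le_const2) auto
  then show "AE x in \<mu>. norm (\<Sum>n. s n * F n x) \<le> ((\<Sum>n. (s n)\<^sup>2) + K) / 2"
    using sp by (intro AE_I2) simp
  show "(\<lambda>x. \<Sum>n. s n * F n x) \<in> borel_measurable \<mu>"
    using features_integrable
    by (intro borel_measurable_suminf borel_measurable_times borel_measurable_const) auto
qed

text \<open>The functional on l2 given by \<open>s\<close> commutes with the integral: its partial
  sums on features are bounded by a constant, which is integrable for a finite measure.\<close>

lemma integral_feature_series:
  assumes s: "summable (\<lambda>n. (s n)\<^sup>2)"
  shows "(\<lambda>n. s n * (\<integral>x. F n x \<partial>\<mu>)) sums (\<integral>x. (\<Sum>n. s n * F n x) \<partial>\<mu>)"
proof -
  have sp: "space \<mu> = space M" by (rule sets_eq_imp_space_eq[OF sets_\<mu>])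
  have "(\<lambda>n. \<integral>x. s n * F n x \<partial>\<mu>) sums (\<integral>x. (\<Sum>n. s n * F n x) \<partial>\<mu>)"
    by (rule sums_integral_dominated[where D = "\<lambda>_. ((\<Sum>n. (s n)\<^sup>2) + K) / 2"])
      (use sp feature_series_bound[OF s] in \<open>auto intro!: integrable_mult_right features_integrable
        summable_sums feature_series_summable[OF s] simp del: divide_le_eq_numeral1 le_divide_eq_numeral1\<close>)
  then show ?thesis by simp
qed

lemma integral_kernel_sums:
  assumes "y \<in> space M"
  shows "(\<lambda>n. F n y * (\<integral>x. F n x \<partial>\<mu>)) sums (\<integral>x. \<kappa> y x \<partial>\<mu>)"
proof -
  have "(\<integral>x. (\<Sum>n. F n y * F n x) \<partial>\<mu>) = (\<integral>x. \<kappa> y x \<partial>\<mu>)"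
    using features_sums[OF assms] sets_eq_imp_space_eq[OF sets_\<mu>]
    by (intro Bochner_Integration.integral_cong) (auto simp: sums_iff)
  then show ?thesis
    using integral_feature_series[OF features_square_summable[OF assms]] by simp
qed

end

section \<open>Mean vectors of probability measures\<close>

text \<open>A partial sum of squared means is the double integral over \<mu> of
  \<open>\<Sum>n<N. F n x * F n y\<close>, whose absolute value is at most \<open>K\<close>.\<close>

lemma integral_features_square_summable:
  assumes "prob_space \<mu>" and sets: "sets \<mu> = sets M"
  shows "summable (\<lambda>n. (\<integral>x. F n x \<partial>\<mu>)\<^sup>2)"
proof (rule summable_squares_if_bounded)
  interpret prob_space \<mu> by fact
  note int = features_integrable[OF finite_measure_axioms sets]
  have sp: "space \<mu> = space M" by (rule sets_eq_imp_space_eq[OF sets])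
  define b where "b n = (\<integral>x. F n x \<partial>\<mu>)" for n
  fix N
  have "(\<Sum>n<N. F n x * b n) \<le> K" if "x \<in> space \<mu>" for x
  proof -
    have "(\<Sum>n<N. F n x * b n) = (\<integral>y. (\<Sum>n<N. F n x * F n y) \<partial>\<mu>)"
      unfolding b_def by (subst Bochner_Integration.integral_sum) (auto intro: int)
    also have "\<dots> \<le> K"
      using feature_sum_bound[of x _ N] that sp
      by (intro integral_le_const Bochner_Integration.integrable_sum integrable_mult_right int)
        (auto simp: abs_le_iff)
    finally show ?thesis .
  qed
  moreover have "(\<Sum>n<N. b n * b n) = (\<integral>x. (\<Sum>n<N. F n x * b n) \<partial>\<mu>)"
    by (subst Bochner_Integration.integral_sum) (auto simp: b_def intro: int)
  ultimately have "(\<Sum>n<N. b n * b n) \<le> K"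
    by (auto intro!: integral_le_const Bochner_Integration.integrable_sum integrable_mult_left int)
  then show "(\<Sum>n<N. (\<integral>x. F n x \<partial>\<mu>)\<^sup>2) \<le> K"
    by (simp add: b_def power2_eq_square)
qed

text \<open>The difference \<open>s\<close> of the mean vectors is orthogonal in l2 to every feature
  vector. Integrating this over both measures shows that \<open>s\<close> is orthogonal to both
  means, hence to itself.\<close>

lemma integral_features_eq_if_mean_embedding_eq:
  assumes \<mu>: "prob_space \<mu>" "sets \<mu> = sets M" and \<mu>': "prob_space \<mu>'" "sets \<mu>' = sets M"
    and eq: "mean_embedding \<kappa> \<mu> = mean_embedding \<kappa> \<mu>'"
  shows "(\<integral>x. F n x \<partial>\<mu>) = (\<integral>x. F n x \<partial>\<mu>')"
proof -
  define s where "s n = (\<integral>x. F n x \<partial>\<mu>) - (\<integral>x. F n x \<partial>\<mu>')" for n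
  note fin = prob_space.finite_measure[OF \<mu>(1)] prob_space.finite_measure[OF \<mu>'(1)]
  have sp: "space \<mu> = space M" "space \<mu>' = space M"
    using \<mu>(2) \<mu>'(2) by (auto dest: sets_eq_imp_space_eq)
  have s: "summable (\<lambda>n. (s n)\<^sup>2)"
    unfolding s_def by (intro summable_square_diff integral_features_square_summable \<mu> \<mu>')
  have "(\<Sum>n. s n * F n y) = 0" if y: "y \<in> space M" for y
  proof -
    have "(\<integral>x. \<kappa> y x \<partial>\<mu>) = (\<integral>x. \<kappa> y x \<partial>\<mu>')"
      using fun_cong[OF eq, of y] y sp by (simp add: mean_embedding_def)
    then have "(\<lambda>n. F n y * (\<integral>x. F n x \<partial>\<mu>) - F n y * (\<integral>x. F n x \<partial>\<mu>')) sums 0"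
      using sums_diff[OF integral_kernel_sums[OF fin(1) \<mu>(2) y] integral_kernel_sums[OF fin(2) \<mu>'(2) y]]
      by simp
    then show ?thesis by (simp add: s_def sums_iff algebra_simps)
  qed
  then have "(\<integral>x. (\<Sum>n. s n * F n x) \<partial>\<mu>) = 0" "(\<integral>x. (\<Sum>n. s n * F n x) \<partial>\<mu>') = 0"
    using sp by (auto intro!: integral_eq_zero_AE)
  then have "(\<lambda>n. s n * (\<integral>x. F n x \<partial>\<mu>) - s n * (\<integral>x. F n x \<partial>\<mu>')) sums 0"
    using sums_diff[OF integral_feature_series[OF fin(1) \<mu>(2) s] integral_feature_series[OF fin(2) \<mu>'(2) s]]
    by simp
  then have "(\<lambda>n. (s n)\<^sup>2) sums 0"
    by (simp add: s_def power2_eq_square algebra_simps)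
  then have "(s n)\<^sup>2 = 0"
    using suminf_eq_zero_iff[OF s] by (simp add: sums_iff)
  then show ?thesis by (simp add: s_def)
qed

text \<open>
  Greedy choice of sample points: if \<open>t\<close> is the current error minus \<open>b\<close>, then the inner product of
  \<open>t\<close> with \<open>F x - b\<close> has expectation zero, so it is nonpositive for some point \<open>x\<close>; appending such
  an \<open>x\<close> raises the squared error by at most \<open>K\<close>.
\<close>

lemma exists_combination_near_mean:
  assumes "prob_space \<mu>" and sets: "sets \<mu> = sets M"
  defines "b \<equiv> \<lambda>m. \<integral>x. F m x \<partial>\<mu>"
  shows "\<exists>c. finite {x. c x \<noteq> 0} \<and> {x. c x \<noteq> 0} \<subseteq> space M \<and>
    (\<Sum>m. ((\<Sum>x | c x \<noteq> 0. c x * F m x) - real n * b m)\<^sup>2) \<le> real n * K"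
proof (induction n)
  case 0
  show ?case by (intro exI[of _ "\<lambda>_. 0"]) simp
next
  case (Suc n)
  interpret prob_space \<mu> by fact
  have sp: "space \<mu> = space M" by (rule sets_eq_imp_space_eq[OF sets])
  have b: "summable (\<lambda>m. (b m)\<^sup>2)"
    unfolding b_def by (rule integral_features_square_summable[OF prob_space_axioms sets])
  obtain c where c: "finite {x. c x \<noteq> 0}" "{x. c x \<noteq> 0} \<subseteq> space M"
    and le: "(\<Sum>m. ((\<Sum>x | c x \<noteq> 0. c x * F m x) - real n * b m)\<^sup>2) \<le> real n * K"
    using Suc.IH by blast
  define u where "u m = (\<Sum>x | c x \<noteq> 0. c x * F m x)" for m
  define s where "s m = u m - real n * b m" for m
  define t where "t m = s m - b m" for m
  have u: "summable (\<lambda>m. (u m)\<^sup>2)"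
    using kernel_form_sums[of "{x. c x \<noteq> 0}" "\<lambda>x. x" c] c unfolding u_def by (auto simp: sums_iff)
  have s: "summable (\<lambda>m. (s m)\<^sup>2)"
    unfolding s_def by (intro summable_square_diff summable_square_scale u b)
  have t: "summable (\<lambda>m. (t m)\<^sup>2)"
    unfolding t_def by (intro summable_square_diff s b)
  have "\<exists>x\<in>space \<mu>. (\<Sum>m. t m * F m x) \<le> (\<Sum>m. t m * b m)"
  proof (rule ccontr)
    note fin = finite_measure_axioms
    assume "\<not> ?thesis"
    then have "AE x in \<mu>. (\<Sum>m. t m * b m) < (\<Sum>m. t m * F m x)"
      by (intro AE_I2) (auto simp: not_le)
    then have "(\<Sum>m. t m * b m) < (\<integral>x. (\<Sum>m. t m * F m x) \<partial>\<mu>)"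
      by (intro expectation_greater integrable_feature_series[OF fin sets t])
    then show False
      using integral_feature_series[OF fin sets t] by (simp add: b_def sums_iff)
  qed
  then obtain x where x: "x \<in> space M" and tx: "(\<Sum>m. t m * F m x) \<le> (\<Sum>m. t m * b m)"
    using sp by blast
  note Fx = features_square_summable[OF x]
  \<comment> \<open>The coefficient is raised by 1 instead of being set to 1, because
    \<open>x\<close> may already lie in the support of \<open>c\<close>.\<close>
  define c' where "c' = c(x := c x + 1)"
  have supp: "{y. c' y \<noteq> 0} \<subseteq> insert x {y. c y \<noteq> 0}" by (auto simp: c'_def)
  have u': "(\<Sum>y | c' y \<noteq> 0. c' y * F m y) = u m + F m x" for m
  proof -
    let ?I = "insert x {y. c y \<noteq> 0}"
    have "(\<Sum>y | c' y \<noteq> 0. c' y * F m y) = (\<Sum>y\<in>?I. c' y * F m y)"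
      using supp c(1) by (intro sum.mono_neutral_left) auto
    also have "\<dots> = (\<Sum>y\<in>?I. c y * F m y + (if y = x then F m x else 0))"
      by (intro sum.cong refl) (auto simp: c'_def algebra_simps)
    also have "\<dots> = (\<Sum>y\<in>?I. c y * F m y) + F m x"
      using c(1) by (simp add: sum.distrib del: sum.insert)
    also have "(\<Sum>y\<in>?I. c y * F m y) = u m"
      unfolding u_def using c(1) by (intro sum.mono_neutral_right) auto
    finally show ?thesis .
  qed
  \<comment> \<open>The new error is \<open>t + F x\<close>. Its squared norm is expanded, the cross
    term is bounded by that of \<open>t\<close> with \<open>b\<close>, and \<open>t + b = s\<close>
    turns the result into the old squared error plus \<open>\<kappa> x x\<close> minus the squared
    norm of \<open>b\<close>.\<close>
  have "(\<lambda>m. (t m)\<^sup>2 + 2 * (t m * F m x) + (F m x)\<^sup>2) sums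
      ((\<Sum>m. (t m)\<^sup>2) + 2 * (\<Sum>m. t m * F m x) + (\<Sum>m. (F m x)\<^sup>2))"
    by (intro sums_add sums_mult summable_sums t Fx summable_mult_of_summable_squares)
  moreover have "(\<lambda>m. (s m)\<^sup>2 - (b m)\<^sup>2) sums ((\<Sum>m. (s m)\<^sup>2) - (\<Sum>m. (b m)\<^sup>2))"
    by (intro sums_diff summable_sums s b)
  moreover have "(\<lambda>m. (t m)\<^sup>2 + 2 * (t m * b m)) sums ((\<Sum>m. (t m)\<^sup>2) + 2 * (\<Sum>m. t m * b m))"
    by (intro sums_add sums_mult summable_sums t b summable_mult_of_summable_squares)
  moreover have "(t m)\<^sup>2 + 2 * (t m * F m x) + (F m x)\<^sup>2 = (u m + F m x - real (Suc n) * b m)\<^sup>2"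
    "(t m)\<^sup>2 + 2 * (t m * b m) = (s m)\<^sup>2 - (b m)\<^sup>2" for m
    by (simp_all add: t_def s_def power2_eq_square algebra_simps)
  ultimately have "(\<Sum>m. (u m + F m x - real (Suc n) * b m)\<^sup>2) =
        (\<Sum>m. (t m)\<^sup>2) + 2 * (\<Sum>m. t m * F m x) + (\<Sum>m. (F m x)\<^sup>2)"
      "(\<Sum>m. (t m)\<^sup>2) + 2 * (\<Sum>m. t m * b m) = (\<Sum>m. (s m)\<^sup>2) - (\<Sum>m. (b m)\<^sup>2)"
    by (auto simp: sums_iff)
  moreover have "(\<Sum>m. (b m)\<^sup>2) \<ge> 0" by (intro suminf_nonneg b) simp
  moreover have "(\<Sum>m. (s m)\<^sup>2) \<le> real n * K" using le by (simp add: s_def u_def)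
  ultimately have "(\<Sum>m. (u m + F m x - real (Suc n) * b m)\<^sup>2) \<le> real (Suc n) * K"
    using tx features_square_suminf[OF x] diag_bound[OF x] by (simp add: algebra_simps)
  then show ?case
    using finite_subset[OF supp] supp c x by (intro exI[of _ c']) (auto simp: u')
qed

text \<open>Dividing an \<open>n\<close>-point sum by \<open>n\<close> leaves a squared error of at
  most \<open>K / n\<close> from the mean vector. These sample means converge in l2, hence are
  Cauchy in the kernel norm, and Cauchy-Schwarz gives the pointwise limits.\<close>

lemma mean_embedding_in_rkhs:
  assumes "prob_space \<mu>" and sets: "sets \<mu> = sets M"
  shows "mean_embedding \<kappa> \<mu> \<in> rkhs (space M) \<kappa>"
proof -
  interpret prob_space \<mu> by fact
  have sp: "space \<mu> = space M" by (rule sets_eq_imp_space_eq[OF sets])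
  define b where "b m = (\<integral>x. F m x \<partial>\<mu>)" for m
  have b: "summable (\<lambda>m. (b m)\<^sup>2)"
    unfolding b_def by (rule integral_features_square_summable[OF prob_space_axioms sets])
  define U where "U c m = (\<Sum>x | c x \<noteq> 0. c x * F m x)" for c m
  have U_super: "U c m = (\<Sum>x\<in>I. c x * F m x)" if "finite I" "{x. c x \<noteq> 0} \<subseteq> I" for c m I
    unfolding U_def using that by (intro sum.mono_neutral_left) auto
  have norm2: "(\<lambda>m. (U c m)\<^sup>2) sums kernel_norm2 \<kappa> c"
    if "finite {x. c x \<noteq> 0}" "{x. c x \<noteq> 0} \<subseteq> space M" for c
    unfolding U_def kernel_norm2_def using that by (intro kernel_form_sums) auto
  have "\<forall>n. \<exists>c. finite {x. c x \<noteq> 0} \<and> {x. c x \<noteq> 0} \<subseteq> space M \<and>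
      (\<Sum>m. (U c m - real n * b m)\<^sup>2) \<le> real n * K"
    using exists_combination_near_mean[OF assms] unfolding U_def b_def by blast
  from choice[OF this] obtain C where C: "\<And>n. finite {x. C n x \<noteq> 0}" "\<And>n. {x. C n x \<noteq> 0} \<subseteq> space M"
    and C_le: "\<And>n. (\<Sum>m. (U (C n) m - real n * b m)\<^sup>2) \<le> real n * K"
    by blast
  \<comment> \<open>The shift to \<open>Suc n\<close> keeps the divisor nonzero.\<close>
  define c where "c n x = C (Suc n) x / real (Suc n)" for n x
  define v where "v n m = U (c n) m - b m" for n m
  have supp: "{x. c n x \<noteq> 0} = {x. C (Suc n) x \<noteq> 0}" for n
    by (auto simp: c_def)
  have c: "finite {x. c n x \<noteq> 0}" "{x. c n x \<noteq> 0} \<subseteq> space M" for n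
    using C by (auto simp: supp)
  have "summable (\<lambda>m. (U (c n) m)\<^sup>2)" for n
    using norm2[OF c] by (simp add: sums_iff)
  then have v: "summable (\<lambda>m. (v n m)\<^sup>2)" for n
    unfolding v_def by (intro summable_square_diff b)
  have v_le: "(\<Sum>m. (v n m)\<^sup>2) \<le> K * inverse (real (Suc n))" for n
  proof -
    have "U (C (Suc n)) m - real (Suc n) * b m = real (Suc n) * v n m" for m
    proof -
      have "U (C (Suc n)) m = real (Suc n) * U (c n) m"
        unfolding U_def supp sum_distrib_left by (intro sum.cong refl) (simp add: c_def)
      then show ?thesis by (simp add: v_def algebra_simps)
    qed
    then have "(real (Suc n))\<^sup>2 * (\<Sum>m. (v n m)\<^sup>2) \<le> real (Suc n) * K"
      using C_le[of "Suc n"] suminf_mult[OF v] by (simp only: power_mult_distrib)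
    then have "real (Suc n) * (\<Sum>m. (v n m)\<^sup>2) \<le> K"
      by (simp only: power2_eq_square mult.assoc mult_le_cancel_left_pos of_nat_0_less_iff zero_less_Suc)
    then show ?thesis by (simp add: field_simps)
  qed
  have lim: "(\<lambda>n. a * (K * inverse (real (Suc n)))) \<longlonglongrightarrow> 0" for a
    using tendsto_mult[OF tendsto_const[of "a * K"] LIMSEQ_inverse_real_of_nat] by (simp add: mult.assoc)
  \<comment> \<open>The kernel norm of a combination is the l2 norm of its feature vector, so two
    sample means are compared through their common limit \<open>b\<close>.\<close>
  have dist: "kernel_norm2 \<kappa> (\<lambda>x. c m x - c n x) \<le> 2 * (\<Sum>i. (v m i)\<^sup>2) + 2 * (\<Sum>i. (v n i)\<^sup>2)" for m n
  proof -
    let ?d = "\<lambda>x. c m x - c n x" and ?I = "{x. c m x \<noteq> 0} \<union> {x. c n x \<noteq> 0}"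
    have I: "finite ?I" "?I \<subseteq> space M" "{x. ?d x \<noteq> 0} \<subseteq> ?I" using c by auto
    have "U ?d i = v m i - v n i" for i
      using U_super[OF I(1), of ?d] U_super[OF I(1), of "c m"] U_super[OF I(1), of "c n"] I(3)
      by (simp add: v_def left_diff_distrib sum_subtractf)
    then have "kernel_norm2 \<kappa> ?d = (\<Sum>i. (v m i - v n i)\<^sup>2)"
      using norm2[OF finite_subset[OF I(3,1)] order_trans[OF I(3,2)]] by (simp add: sums_iff)
    also have "\<dots> \<le> (\<Sum>i. 2 * (v m i)\<^sup>2 + 2 * (v n i)\<^sup>2)"
    proof (intro suminf_le summable_add summable_mult summable_square_diff v)
      show "(v m i - v n i)\<^sup>2 \<le> 2 * (v m i)\<^sup>2 + 2 * (v n i)\<^sup>2" for i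
        using zero_le_power2[of "v m i + v n i"] by (simp add: power2_sum power2_diff)
    qed
    also have "\<dots> = 2 * (\<Sum>i. (v m i)\<^sup>2) + 2 * (\<Sum>i. (v n i)\<^sup>2)"
      by (simp add: suminf_add[symmetric] suminf_mult summable_mult v)
    finally show ?thesis .
  qed
  have Cauchy: "\<exists>N. \<forall>m\<ge>N. \<forall>n\<ge>N. kernel_norm2 \<kappa> (\<lambda>x. c m x - c n x) < e" if e: "e > 0" for e
  proof -
    obtain N where N: "\<And>n. n \<ge> N \<Longrightarrow> 2 * (K * inverse (real (Suc n))) < e / 2"
      using order_tendstoD(2)[OF lim[of 2], of "e / 2"] e
      unfolding eventually_sequentially by auto
    have "kernel_norm2 \<kappa> (\<lambda>x. c m x - c n x) < e" if "m \<ge> N" "n \<ge> N" for m n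
      using dist[of m n] v_le[of m] v_le[of n] N[OF that(1)] N[OF that(2)] by linarith
    then show ?thesis by blast
  qed
  have pointwise: "(\<lambda>n. kernel_combination \<kappa> (c n) y) \<longlonglongrightarrow> (\<integral>x. \<kappa> y x \<partial>\<mu>)" if y: "y \<in> space M" for y
  proof -
    have sq: "(kernel_combination \<kappa> (c n) y - (\<integral>x. \<kappa> y x \<partial>\<mu>))\<^sup>2 \<le> \<kappa> y y * (K * inverse (real (Suc n)))" for n
    proof -
      have "(\<lambda>m. \<Sum>x | c n x \<noteq> 0. c n x * (F m y * F m x)) sums kernel_combination \<kappa> (c n) y"
        unfolding kernel_combination_def using c(2)[of n] y by (intro sums_sum sums_mult features_sums) auto
      then have "(\<lambda>m. F m y * U (c n) m) sums kernel_combination \<kappa> (c n) y"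
        by (simp add: U_def sum_distrib_left mult.left_commute)
      from sums_diff[OF this integral_kernel_sums[OF finite_measure_axioms sets y]]
      have "(\<lambda>m. F m y * v n m) sums (kernel_combination \<kappa> (c n) y - (\<integral>x. \<kappa> y x \<partial>\<mu>))"
        by (simp add: v_def b_def algebra_simps)
      then have "(kernel_combination \<kappa> (c n) y - (\<integral>x. \<kappa> y x \<partial>\<mu>))\<^sup>2 \<le> \<kappa> y y * (\<Sum>m. (v n m)\<^sup>2)"
        using Cauchy_Schwarz_suminf[OF features_square_summable[OF y] v[of n]]
          features_square_suminf[OF y] by (simp add: sums_iff)
      also have "\<dots> \<le> \<kappa> y y * (K * inverse (real (Suc n)))"
        using v_le positive_definite_on_diag_nonneg[OF positive_definite y] by (rule mult_left_mono)
      finally show ?thesis .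
    qed
    have "(\<lambda>n. (kernel_combination \<kappa> (c n) y - (\<integral>x. \<kappa> y x \<partial>\<mu>))\<^sup>2) \<longlonglongrightarrow> 0"
      by (rule tendsto_sandwich[OF _ _ tendsto_const lim[of "\<kappa> y y"]]) (use sq in auto)
    then have "(\<lambda>n. kernel_combination \<kappa> (c n) y - (\<integral>x. \<kappa> y x \<partial>\<mu>)) \<longlonglongrightarrow> 0"
      using tendsto_real_sqrt by (fastforce intro: tendsto_rabs_zero_cancel)
    then show ?thesis by (simp add: LIM_zero_iff)
  qed
  show ?thesis
    unfolding rkhs_def mem_Collect_eq mean_embedding_def sp
    by (intro conjI exI[of _ c] allI impI ballI restrict_extensional c Cauchy)
      (simp_all add: pointwise)
qed

end

section \<open>Characteristic kernels and positive measures\<close>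

text \<open>For a positive measure the supremum over subsets of \<open>A\<close> is attained at
  \<open>A\<close> itself, by monotonicity.\<close>

lemma positive_variation_measure:
  assumes "finite_measure \<mu>" and sets: "sets \<mu> = sets borel"
  shows "positive_variation (measure \<mu>) = \<mu>"
proof -
  interpret finite_measure \<mu> by fact
  have "(SUP B\<in>{B \<in> sets borel. B \<subseteq> A}. ennreal (measure \<mu> B)) = emeasure \<mu> A"
    if "A \<in> sets borel" for A
    unfolding emeasure_eq_measure using that sets
    by (intro antisym SUP_least SUP_upper) (auto intro!: ennreal_leI finite_measure_mono)
  then have "positive_variation (measure \<mu>) = measure_of UNIV (sets borel) (emeasure \<mu>)"
    unfolding positive_variation_def by (intro measure_of_eq) (auto simp: sets.sigma_sets_eq[of borel, simplified])
  also have "\<dots> = \<mu>"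
    using measure_of_of_measure[of \<mu>] sets sets_eq_imp_space_eq[OF sets] by simp
  finally show ?thesis .
qed

lemma positive_variation_nonpos:
  assumes "\<And>A. \<nu> A \<le> 0"
  shows "positive_variation \<nu> = null_measure borel"
proof -
  have "(SUP B\<in>{B \<in> sets borel. B \<subseteq> A}. ennreal (\<nu> B)) = 0" for A
    using assms by (intro antisym SUP_least) (auto simp: ennreal_neg)
  then have "positive_variation \<nu> = measure_of UNIV (sets borel) (emeasure (null_measure borel))"
    unfolding positive_variation_def
    by (intro measure_of_eq) (simp_all add: sets.sigma_sets_eq[of borel, simplified])
  then show ?thesis
    using measure_of_of_measure[of "null_measure borel"] by simp
qed

lemma measure_in_finite_signed_measures:
  assumes "finite_measure \<mu>" and sets: "sets \<mu> = sets borel"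
  shows "measure \<mu> \<in> finite_signed_measures"
proof -
  interpret finite_measure \<mu> by fact
  show ?thesis
    unfolding finite_signed_measures_def
    using sets finite_measure_UNION by (auto simp: measure_notin_sets)
qed

lemma signed_mean_embedding_measure:
  assumes "finite_measure \<mu>" "sets \<mu> = sets borel"
  shows "signed_mean_embedding \<kappa> (measure \<mu>) = (\<lambda>y. \<integral>x. \<kappa> y x \<partial>\<mu>)"
  using positive_variation_measure[OF assms] positive_variation_nonpos[of "\<lambda>A. - measure \<mu> A"]
  by (simp add: signed_mean_embedding_def signed_integral_def)

text \<open>Finite positive measures are signed measures whose negative part is null, so their
  signed mean embeddings are ordinary integrals and injectivity applies.\<close>

lemma characteristic_on_signed_measure_eqI:
  assumes char: "characteristic_on_signed \<kappa> finite_signed_measures"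
    and \<mu>: "finite_measure \<mu>" "sets \<mu> = sets borel" and \<nu>: "finite_measure \<nu>" "sets \<nu> = sets borel"
    and eq: "\<And>y. (\<integral>x. \<kappa> y x \<partial>\<mu>) = (\<integral>x. \<kappa> y x \<partial>\<nu>)"
  shows "\<mu> = \<nu>"
proof -
  have "measure \<mu> = measure \<nu>"
    using char unfolding characteristic_on_signed_def
    by (auto intro!: inj_onD[where f = "signed_mean_embedding \<kappa>"] measure_in_finite_signed_measures \<mu> \<nu>
        simp: signed_mean_embedding_measure \<mu> \<nu> eq)
  then show ?thesis
    using finite_measure.emeasure_eq_measure[OF \<mu>(1)] finite_measure.emeasure_eq_measure[OF \<nu>(1)] \<mu>(2) \<nu>(2)
    by (intro measure_eqI) auto
qed

section \<open>Averaging over the group\<close>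

lemma space_orbit_space: "space (orbit_space \<phi>) = range (orbit \<phi>)"
  unfolding orbit_space_def by (rule space_measure_of) blast

lemma measurable_orbit: "orbit \<phi> \<in> borel \<rightarrow>\<^sub>M orbit_space \<phi>"
  unfolding orbit_space_def by (rule measurable_measure_of) auto

lemma in_sets_orbit_spaceI:
  "A \<subseteq> range (orbit \<phi>) \<Longrightarrow> orbit \<phi> -` A \<in> sets borel \<Longrightarrow> A \<in> sets (orbit_space \<phi>)"
  unfolding orbit_space_def by (rule in_measure_of) auto

locale weighted_action =
  fixes \<phi> :: "'g::topological_group_add \<Rightarrow> 'x::topological_space \<Rightarrow> 'x"
    and \<eta> :: "'g measure" and \<rho> :: "'x \<Rightarrow> real"
  assumes haar: "unimodular_haar_measure \<eta>"
    and action: "measurable_action \<phi>"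
    and weight_measurable [measurable]: "\<rho> \<in> borel_measurable borel"
    and weight_pos: "0 < \<rho> x"
    and weight: "\<eta> \<in> weighted_measures \<phi> \<rho>"
begin

sublocale haar: sigma_finite_measure \<eta>
  using haar by (simp add: unimodular_haar_measure_def)

lemma sets_haar [measurable_cong]: "sets \<eta> = sets borel"
  using haar by (simp add: unimodular_haar_measure_def)

lemma space_haar: "space \<eta> = UNIV"
  using sets_eq_imp_space_eq[OF sets_haar] by simp

lemma action_zero: "\<phi> 0 x = x" and action_add: "\<phi> (g + h) x = \<phi> g (\<phi> h x)"
  using action by (simp_all add: measurable_action_def)

lemma action_measurable [measurable]: "(\<lambda>(x, g). \<phi> g x) \<in> borel \<Otimes>\<^sub>M borel \<rightarrow>\<^sub>M borel"
proof -
  have "(\<lambda>(g, x). \<phi> g x) \<in> borel \<Otimes>\<^sub>M borel \<rightarrow>\<^sub>M borel"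
    using action by (simp add: measurable_action_def)
  from measurable_pair_swap[OF this] show ?thesis by simp
qed

lemma orbit_eq_iff: "orbit \<phi> x = orbit \<phi> y \<longleftrightarrow> (\<exists>g. y = \<phi> g x)"
proof
  have "y = \<phi> 0 y" by (simp add: action_zero)
  then have "y \<in> orbit \<phi> y" unfolding orbit_def by blast
  then show "orbit \<phi> x = orbit \<phi> y \<Longrightarrow> \<exists>g. y = \<phi> g x" by (auto simp: orbit_def)
next
  assume "\<exists>g. y = \<phi> g x"
  then obtain g where g: "y = \<phi> g x" by blast
  have "\<phi> h y = \<phi> (h + g) x" "\<phi> h x = \<phi> (h + - g) y" for h
    unfolding g action_add[symmetric] by (simp_all add: add.assoc)
  then show "orbit \<phi> x = orbit \<phi> y" unfolding orbit_def by blast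
qed

lemma orbit_action: "orbit \<phi> (\<phi> g x) = orbit \<phi> x"
  using orbit_eq_iff[of x "\<phi> g x"] by auto

lemma measurable_haar_translate [measurable]: "(\<lambda>g. g + h) \<in> \<eta> \<rightarrow>\<^sub>M \<eta>"
  unfolding measurable_cong_sets[OF sets_haar sets_haar]
  by (intro borel_measurable_continuous_onI continuous_intros)

text \<open>Right invariance in pushforward form. Moving \<open>x\<close> to
  \<open>\<phi> h x\<close> replaces \<open>g\<close> by \<open>g + h\<close>, so right translations
  are the ones that make orbit averages invariant.\<close>

lemma distr_haar_translate: "distr \<eta> \<eta> (\<lambda>g. g + h) = \<eta>"
proof (rule measure_eqI)
  fix A assume "A \<in> sets (distr \<eta> \<eta> (\<lambda>g. g + h))"
  then have A: "A \<in> sets borel" by (simp add: sets_haar)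
  have eq: "(\<lambda>g. g + h) -` A = (\<lambda>g. g + - h) ` A"
  proof (intro equalityI subsetI)
    fix g assume "g \<in> (\<lambda>g. g + h) -` A"
    moreover have "g = (g + h) + - h" by (simp add: add.assoc)
    ultimately show "g \<in> (\<lambda>g. g + - h) ` A" by blast
  qed (auto simp: add.assoc)
  have "emeasure \<eta> ((\<lambda>g. g + - h) ` A) = emeasure \<eta> A"
    using haar A unfolding unimodular_haar_measure_def by blast
  then have "emeasure \<eta> ((\<lambda>g. g + h) -` A) = emeasure \<eta> A"
    by (simp only: eq)
  then show "emeasure (distr \<eta> \<eta> (\<lambda>g. g + h)) A = emeasure \<eta> A"
    using A by (simp add: emeasure_distr sets_haar space_haar)
qed simp

section \<open>Weighted averages along orbits\<close>

definition average :: "('x \<Rightarrow> real) \<Rightarrow> 'x \<Rightarrow> real" where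
  "average f x = (\<integral>g. \<rho> (\<phi> g x) * f (\<phi> g x) \<partial>\<eta>)"

text \<open>The function \<open>w\<close> of the overview, taken in \<open>ennreal\<close> so that
  cancelling it can be done inside nonnegative integrals.\<close>

definition orbit_weight :: "'x \<Rightarrow> ennreal" where
  "orbit_weight x = (\<integral>\<^sup>+g. ennreal (\<rho> (\<phi> g x)) \<partial>\<eta>)"

definition weight_sup :: real where
  "weight_sup = enn2real (SUP x. orbit_weight x)"

lemma orbit_weight_le: "orbit_weight x \<le> ennreal weight_sup"
proof -
  have "(SUP x. orbit_weight x) < \<infinity>"
    using weight by (simp add: weighted_measures_def orbit_weight_def)
  then have "(SUP x. orbit_weight x) = ennreal weight_sup"
    by (simp add: weight_sup_def)
  then show ?thesis by (metis SUP_upper UNIV_I)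
qed

lemma orbit_weight_measurable [measurable]: "orbit_weight \<in> borel_measurable borel"
  unfolding orbit_weight_def by measurable

lemma orbit_weight_invariant: "orbit_weight (\<phi> h x) = orbit_weight x"
proof -
  have "orbit_weight x = (\<integral>\<^sup>+g. ennreal (\<rho> (\<phi> g x)) \<partial>distr \<eta> \<eta> (\<lambda>g. g + h))"
    by (simp add: orbit_weight_def distr_haar_translate)
  also have "\<dots> = orbit_weight (\<phi> h x)"
    by (subst nn_integral_distr) (auto simp: orbit_weight_def action_add)
  finally show ?thesis by simp
qed

text \<open>A strictly positive function has integral zero only for the null measure, and Haar
  measure is nonzero.\<close>

lemma orbit_weight_pos: "0 < orbit_weight x"
proof (rule ccontr)
  assume "\<not> 0 < orbit_weight x"
  then have "AE g in \<eta>. ennreal (\<rho> (\<phi> g x)) = 0"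
    unfolding orbit_weight_def by (subst (asm) not_gr_zero, subst (asm) nn_integral_0_iff_AE) auto
  moreover have "\<rho> z \<noteq> 0 \<and> \<not> \<rho> z \<le> 0" for z using weight_pos[of z] by simp
  ultimately have "AE g in \<eta>. False" by (simp add: ennreal_eq_0_iff)
  then have "emeasure \<eta> UNIV = 0"
    by (simp add: AE_iff_measurable[of "space \<eta>"] space_haar)
  then show False using haar by (simp add: unimodular_haar_measure_def)
qed

lemma weight_integrable: "integrable \<eta> (\<lambda>g. \<rho> (\<phi> g x))"
  and weight_integral_le: "(\<integral>g. \<rho> (\<phi> g x) \<partial>\<eta>) \<le> weight_sup"
proof -
  have "(\<integral>\<^sup>+g. ennreal (\<rho> (\<phi> g x)) \<partial>\<eta>) \<le> ennreal weight_sup"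
    using orbit_weight_le by (simp add: orbit_weight_def)
  then show int: "integrable \<eta> (\<lambda>g. \<rho> (\<phi> g x))"
    using weight_pos by (intro integrableI_bounded) (auto simp: less_imp_le intro: le_less_trans)
  have "ennreal (\<integral>g. \<rho> (\<phi> g x) \<partial>\<eta>) \<le> ennreal weight_sup"
    using orbit_weight_le[of x] weight_pos
    by (simp add: orbit_weight_def nn_integral_eq_integral[OF int] less_imp_le)
  then show "(\<integral>g. \<rho> (\<phi> g x) \<partial>\<eta>) \<le> weight_sup"
    by (simp add: weight_sup_def)
qed

lemma weighted_integrable:
  assumes [measurable]: "f \<in> borel_measurable borel" and "\<And>z. \<bar>f z\<bar> \<le> D"
  shows "integrable \<eta> (\<lambda>g. \<rho> (\<phi> g x) * f (\<phi> g x))"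
proof (rule Bochner_Integration.integrable_bound)
  show "integrable \<eta> (\<lambda>g. \<rho> (\<phi> g x) * D)"
    by (intro integrable_mult_left weight_integrable)
  have "0 \<le> D" using assms(2) abs_ge_zero order_trans by blast
  then show "AE g in \<eta>. norm (\<rho> (\<phi> g x) * f (\<phi> g x)) \<le> norm (\<rho> (\<phi> g x) * D)"
    using assms(2) weight_pos by (intro AE_I2) (auto simp: abs_mult intro!: mult_left_mono)
qed measurable

lemma average_measurable [measurable]:
  assumes [measurable]: "f \<in> borel_measurable borel"
  shows "average f \<in> borel_measurable borel"
  unfolding average_def by measurable

lemma average_invariant:
  assumes [measurable]: "f \<in> borel_measurable borel"
  shows "average f (\<phi> h x) = average f x"
proof -
  have "average f x = (\<integral>g. \<rho> (\<phi> g x) * f (\<phi> g x) \<partial>distr \<eta> \<eta> (\<lambda>g. g + h))"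
    by (simp add: average_def distr_haar_translate)
  also have "\<dots> = average f (\<phi> h x)"
    by (subst integral_distr) (auto simp: average_def action_add)
  finally show ?thesis by simp
qed

lemma abs_average_le:
  assumes [measurable]: "f \<in> borel_measurable borel" and f: "\<And>z. \<bar>f z\<bar> \<le> D"
  shows "\<bar>average f x\<bar> \<le> D * weight_sup"
proof -
  have D: "0 \<le> D" using f abs_ge_zero order_trans by blast
  have "\<bar>average f x\<bar> \<le> (\<integral>g. \<bar>\<rho> (\<phi> g x) * f (\<phi> g x)\<bar> \<partial>\<eta>)"
    unfolding average_def by (rule integral_abs_bound)
  also have "\<dots> \<le> (\<integral>g. \<rho> (\<phi> g x) * D \<partial>\<eta>)"
  proof (rule integral_mono)
    show "\<bar>\<rho> (\<phi> g x) * f (\<phi> g x)\<bar> \<le> \<rho> (\<phi> g x) * D" for g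
      using weight_pos[of "\<phi> g x"] f by (auto simp: abs_mult intro!: mult_left_mono)
  qed (intro integrable_abs weighted_integrable[OF assms] integrable_mult_left weight_integrable)+
  also have "\<dots> \<le> weight_sup * D"
    using weight_integral_le D by (simp add: mult_right_mono)
  finally show ?thesis by (simp add: mult.commute)
qed

lemma average_sum:
  assumes "\<And>i. f i \<in> borel_measurable borel" "\<And>i z. \<bar>f i z\<bar> \<le> D i" "finite I"
  shows "average (\<lambda>z. \<Sum>i\<in>I. s i * f i z) x = (\<Sum>i\<in>I. s i * average (f i) x)"
proof -
  have "average (\<lambda>z. \<Sum>i\<in>I. s i * f i z) x = (\<integral>g. (\<Sum>i\<in>I. s i * (\<rho> (\<phi> g x) * f i (\<phi> g x))) \<partial>\<eta>)"
    by (simp add: average_def sum_distrib_left mult.left_commute)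
  also have "\<dots> = (\<Sum>i\<in>I. s i * average (f i) x)"
    by (subst Bochner_Integration.integral_sum)
      (simp_all add: average_def integrable_mult_right weighted_integrable[OF assms(1,2)])
  finally show ?thesis .
qed

text \<open>The constant bound \<open>E\<close> on partial sums becomes the majorant
  \<open>\<rho> (\<phi> g x) * E\<close>, which is integrable even if Haar measure is
  infinite.\<close>

lemma average_sums:
  assumes meas: "\<And>i. f i \<in> borel_measurable borel" and f: "\<And>i z. \<bar>f i z\<bar> \<le> D i"
    and sums: "\<And>z. (\<lambda>i. s i * f i z) sums S z" and bound: "\<And>n z. \<bar>\<Sum>i<n. s i * f i z\<bar> \<le> E"
  shows "(\<lambda>i. s i * average (f i) x) sums average S x"
proof -
  have "(\<lambda>i. \<integral>g. s i * (\<rho> (\<phi> g x) * f i (\<phi> g x)) \<partial>\<eta>) sums (\<integral>g. \<rho> (\<phi> g x) * S (\<phi> g x) \<partial>\<eta>)"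
  proof (rule sums_integral_dominated)
    show "integrable \<eta> (\<lambda>g. \<rho> (\<phi> g x) * E)"
      by (intro integrable_mult_left weight_integrable)
    show "integrable \<eta> (\<lambda>g. s i * (\<rho> (\<phi> g x) * f i (\<phi> g x)))" for i
      by (intro integrable_mult_right weighted_integrable[OF meas f])
    show "(\<lambda>i. s i * (\<rho> (\<phi> g x) * f i (\<phi> g x))) sums (\<rho> (\<phi> g x) * S (\<phi> g x))" for g
      using sums_mult[OF sums, of "\<rho> (\<phi> g x)" "\<phi> g x"] by (simp add: mult.left_commute)
    show "\<bar>\<Sum>i<n. s i * (\<rho> (\<phi> g x) * f i (\<phi> g x))\<bar> \<le> \<rho> (\<phi> g x) * E" for n g
    proof -
      have "(\<Sum>i<n. s i * (\<rho> (\<phi> g x) * f i (\<phi> g x))) = \<rho> (\<phi> g x) * (\<Sum>i<n. s i * f i (\<phi> g x))"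
        by (simp add: sum_distrib_left mult.left_commute)
      then show ?thesis
        using weight_pos[of "\<phi> g x"] bound by (auto simp: abs_mult intro!: mult_left_mono)
    qed
  qed
  then show ?thesis by (simp add: average_def)
qed

section \<open>Sweeping a law along the orbits\<close>

text \<open>The pushforward of \<open>P \<Otimes>\<^sub>M \<eta>\<close> under the action, damped by
  \<rho>: the density makes the total mass finite, so that the characteristic property of
  \<open>k\<close> applies.\<close>

definition sweep :: "'x measure \<Rightarrow> 'x measure" where
  "sweep P = distr (density (P \<Otimes>\<^sub>M \<eta>) (\<lambda>(x, g). ennreal (\<rho> (\<phi> g x)))) borel (\<lambda>(x, g). \<phi> g x)"

lemma sets_sweep: "sets (sweep P) = sets borel"
  by (simp add: sweep_def)

context
  fixes P :: "'x measure"
  assumes prob: "prob_space P" and sets_P [measurable_cong]: "sets P = sets borel"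
begin

interpretation P: prob_space P by (rule prob)

lemma nn_integral_sweep:
  assumes [measurable]: "f \<in> borel_measurable borel"
  shows "(\<integral>\<^sup>+z. f z \<partial>sweep P) = (\<integral>\<^sup>+x. \<integral>\<^sup>+g. ennreal (\<rho> (\<phi> g x)) * f (\<phi> g x) \<partial>\<eta> \<partial>P)"
proof -
  have "(\<integral>\<^sup>+z. f z \<partial>sweep P) = (\<integral>\<^sup>+(x, g). ennreal (\<rho> (\<phi> g x)) * f (\<phi> g x) \<partial>(P \<Otimes>\<^sub>M \<eta>))"
    unfolding sweep_def
    by (subst nn_integral_distr, measurable, subst nn_integral_density)
      (auto intro!: nn_integral_cong simp: case_prod_beta)
  also have "\<dots> = (\<integral>\<^sup>+x. \<integral>\<^sup>+g. ennreal (\<rho> (\<phi> g x)) * f (\<phi> g x) \<partial>\<eta> \<partial>P)"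
    by (subst haar.nn_integral_fst[symmetric]) (auto simp: case_prod_beta)
  finally show ?thesis .
qed

lemma finite_measure_sweep: "finite_measure (sweep P)"
proof (rule finite_measureI)
  have "emeasure (sweep P) (space (sweep P)) = (\<integral>\<^sup>+z. 1 \<partial>sweep P)" by simp
  also have "\<dots> = (\<integral>\<^sup>+x. orbit_weight x \<partial>P)"
    by (subst nn_integral_sweep) (simp_all add: orbit_weight_def[abs_def])
  also have "\<dots> \<le> (\<integral>\<^sup>+x. ennreal weight_sup \<partial>P)"
    by (intro nn_integral_mono orbit_weight_le)
  also have "\<dots> < \<infinity>" by (simp add: P.emeasure_space_1)
  finally show "emeasure (sweep P) (space (sweep P)) \<noteq> \<infinity>" by simp
qed

text \<open>A bounded function is integrable for the finite measure \<open>sweep P\<close>. Carrying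
  integrability back through the pushforward and the density yields the hypothesis of Fubini's
  theorem on the product.\<close>

lemma integral_sweep:
  fixes f :: "'x \<Rightarrow> real"
  assumes [measurable]: "f \<in> borel_measurable borel" and f: "\<And>z. \<bar>f z\<bar> \<le> D"
  shows "(\<integral>z. f z \<partial>sweep P) = (\<integral>x. average f x \<partial>P)"
proof -
  interpret pair_sigma_finite P \<eta> ..
  define a where "a = (\<lambda>(x, g). \<phi> g x)"
  have [measurable]: "a \<in> P \<Otimes>\<^sub>M \<eta> \<rightarrow>\<^sub>M borel" unfolding a_def by measurable
  have sweep: "sweep P = distr (density (P \<Otimes>\<^sub>M \<eta>) (\<lambda>z. ennreal (\<rho> (a z)))) borel a"
    by (simp add: sweep_def a_def case_prod_beta')
  have pos: "AE z in P \<Otimes>\<^sub>M \<eta>. 0 \<le> \<rho> (a z)"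
    by (intro AE_I2 less_imp_le weight_pos)
  have "integrable (sweep P) f"
    by (rule finite_measure.integrable_const_bound[OF finite_measure_sweep, of _ D])
      (auto simp: f sweep_def)
  then have "integrable (density (P \<Otimes>\<^sub>M \<eta>) (\<lambda>z. ennreal (\<rho> (a z)))) (\<lambda>z. f (a z))"
    unfolding sweep by (rule integrable_distr[rotated]) simp
  then have int: "integrable (P \<Otimes>\<^sub>M \<eta>) (\<lambda>z. \<rho> (a z) * f (a z))"
    using integrable_density[OF _ _ pos, of "\<lambda>z. f (a z)"] by simp
  have "(\<integral>z. f z \<partial>sweep P) = (\<integral>z. f (a z) \<partial>density (P \<Otimes>\<^sub>M \<eta>) (\<lambda>z. ennreal (\<rho> (a z))))"
    unfolding sweep by (rule integral_distr) simp_all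
  also have "\<dots> = (\<integral>z. \<rho> (a z) * f (a z) \<partial>(P \<Otimes>\<^sub>M \<eta>))"
    using integral_density[OF _ _ pos, of "\<lambda>z. f (a z)"] by simp
  also have "\<dots> = (\<integral>x. average f x \<partial>P)"
    unfolding integral_fst'[OF int, symmetric] by (simp add: average_def[abs_def] a_def)
  finally show ?thesis .
qed

text \<open>The integrand is constant on orbits, so it leaves the inner integral, which contributes
  the factor \<open>orbit_weight x\<close> and cancels the denominator. Hence \<open>sweep P\<close>
  determines \<open>P\<close> on invariant sets.\<close>

lemma emeasure_invariant_eq_nn_integral_sweep:
  assumes [measurable]: "A \<in> sets borel" and inv: "\<And>g x. \<phi> g x \<in> A \<longleftrightarrow> x \<in> A"
  shows "emeasure P A = (\<integral>\<^sup>+z. indicator A z / orbit_weight z \<partial>sweep P)"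
proof -
  have "(\<integral>\<^sup>+z. indicator A z / orbit_weight z \<partial>sweep P) =
      (\<integral>\<^sup>+x. \<integral>\<^sup>+g. ennreal (\<rho> (\<phi> g x)) * (indicator A x / orbit_weight x) \<partial>\<eta> \<partial>P)"
    using inv by (subst nn_integral_sweep) (auto simp: orbit_weight_invariant indicator_def)
  also have "\<dots> = (\<integral>\<^sup>+x. orbit_weight x * (indicator A x / orbit_weight x) \<partial>P)"
    by (subst nn_integral_multc) (auto simp: orbit_weight_def)
  also have "\<dots> = (\<integral>\<^sup>+x. indicator A x \<partial>P)"
  proof (rule nn_integral_cong)
    fix x
    \<comment> \<open>Cancellation in \<open>ennreal\<close> requires a value that is neither zero
      nor infinite.\<close>
    have "orbit_weight x \<noteq> 0" "orbit_weight x \<noteq> \<top>"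
      using orbit_weight_pos[of x] orbit_weight_le[of x] by (auto simp: top_unique)
    then show "orbit_weight x * (indicator A x / orbit_weight x) = indicator A x"
      by (simp add: ennreal_times_divide ennreal_mult_divide_eq mult.commute)
  qed
  finally show ?thesis using sets_P by simp
qed

end

text \<open>Preimages under \<open>orbit \<phi>\<close> of measurable sets of orbits are invariant
  Borel sets, on which the swept measure determines the law.\<close>

lemma distr_orbit_eq_if_sweep_eq:
  assumes P: "prob_space P" "sets P = sets borel" and Q: "prob_space Q" "sets Q = sets borel"
    and eq: "sweep P = sweep Q"
  shows "distr P (orbit_space \<phi>) (orbit \<phi>) = distr Q (orbit_space \<phi>) (orbit \<phi>)"
proof (rule measure_eqI)
  fix A assume "A \<in> sets (distr P (orbit_space \<phi>) (orbit \<phi>))"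
  then have A: "A \<in> sets (orbit_space \<phi>)" by simp
  have meas: "orbit \<phi> -` A \<in> sets borel"
    using measurable_sets[OF measurable_orbit A] by simp
  have "orbit \<phi> \<in> P \<rightarrow>\<^sub>M orbit_space \<phi>" "orbit \<phi> \<in> Q \<rightarrow>\<^sub>M orbit_space \<phi>"
    using measurable_orbit P(2) Q(2) measurable_cong_sets by blast+
  moreover have "space P = UNIV" "space Q = UNIV"
    using sets_eq_imp_space_eq[OF P(2)] sets_eq_imp_space_eq[OF Q(2)] by simp_all
  moreover have "emeasure P (orbit \<phi> -` A) = emeasure Q (orbit \<phi> -` A)"
    using emeasure_invariant_eq_nn_integral_sweep[OF P meas]
      emeasure_invariant_eq_nn_integral_sweep[OF Q meas] eq by (simp add: orbit_action)
  ultimately show "emeasure (distr P (orbit_space \<phi>) (orbit \<phi>)) A =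
      emeasure (distr Q (orbit_space \<phi>) (orbit \<phi>)) A"
    using A by (simp add: emeasure_distr)
qed simp

section \<open>Invariant functions on the orbit space\<close>

text \<open>The value at a chosen representative; for invariant \<open>f\<close> the choice does not
  affect the value on an orbit.\<close>

definition on_orbits :: "('x \<Rightarrow> 'b) \<Rightarrow> 'x set \<Rightarrow> 'b" where
  "on_orbits f a = f (SOME x. orbit \<phi> x = a)"

lemma on_orbits_orbit:
  assumes "\<And>g x. f (\<phi> g x) = f x"
  shows "on_orbits f (orbit \<phi> x) = f x"
proof -
  have "orbit \<phi> x = orbit \<phi> (SOME y. orbit \<phi> y = orbit \<phi> x)"
    by (rule sym, rule someI) (rule refl)
  then show ?thesis unfolding on_orbits_def using assms orbit_eq_iff by metis
qed

lemma on_orbits_measurable: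
  assumes "\<And>g x. f (\<phi> g x) = f x" and f: "f \<in> borel \<rightarrow>\<^sub>M N"
  shows "on_orbits f \<in> orbit_space \<phi> \<rightarrow>\<^sub>M N"
proof (rule measurableI)
  fix a assume "a \<in> space (orbit_space \<phi>)"
  then show "on_orbits f a \<in> space N"
    using on_orbits_orbit[of f] assms measurable_space[OF f] by (auto simp: space_orbit_space)
next
  fix B assume "B \<in> sets N"
  then have "f -` B \<in> sets borel" using measurable_sets[OF f] by simp
  moreover have "orbit \<phi> -` (on_orbits f -` B \<inter> space (orbit_space \<phi>)) = f -` B"
    using on_orbits_orbit[of f] assms(1) by (auto simp: space_orbit_space)
  ultimately show "on_orbits f -` B \<inter> space (orbit_space \<phi>) \<in> sets (orbit_space \<phi>)"
    by (intro in_sets_orbit_spaceI) (auto simp: space_orbit_space)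
qed

end

section \<open>Features of the averaged kernel\<close>

lemma bounded_continuous_positive_definite_features:
  fixes k :: "'a::second_countable_topology \<Rightarrow> 'a \<Rightarrow> real"
  assumes "continuous_on UNIV (\<lambda>(x, y). k x y)" and "bounded (range (\<lambda>(x, y). k x y))"
    and "positive_definite_on UNIV k"
  obtains e B where "bounded_features borel e k B"
proof -
  obtain e where e: "\<And>n. continuous_on UNIV (e n)" "\<And>x y. (\<lambda>n. e n x * e n y) sums k x y"
    using positive_definite_continuous_expansion[OF assms(1,3)] by blast
  obtain B where B: "\<And>x y. \<bar>k x y\<bar> \<le> B"
    using assms(2) unfolding bounded_iff by auto
  have "k x x \<le> B" for x using B[of x x] by simp
  then have "bounded_features borel e k B"
    using e by unfold_locales (auto intro: borel_measurable_continuous_onI)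
  then show thesis by (rule that)
qed

locale averaged_features = weighted_action \<phi> \<eta> \<rho> + bounded_features borel e k B
  for \<phi> :: "'g::topological_group_add \<Rightarrow> 'x::topological_space \<Rightarrow> 'x"
    and \<eta> :: "'g measure" and \<rho> :: "'x \<Rightarrow> real"
    and e :: "nat \<Rightarrow> 'x \<Rightarrow> real" and k :: "'x \<Rightarrow> 'x \<Rightarrow> real" and B :: real
begin

abbreviation "haar_kernel \<equiv> averaged_kernel \<phi> \<eta> (weighted_kernel \<rho> k)"

lemma feature_measurable [measurable]: "e n \<in> borel_measurable borel"
  by (rule features_measurable)

lemma feature_bounded: "\<bar>e n z\<bar> \<le> sqrt B"
  by (rule feature_abs_le) simp

lemma average_kernel_sums: "(\<lambda>n. e n z * average (e n) x) sums average (k z) x"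
  by (rule average_sums[OF feature_measurable feature_bounded])
    (auto intro!: features_sums feature_sum_bound)

lemma average_kernel_sum_bound: "\<bar>\<Sum>n<N. e n z * average (e n) x\<bar> \<le> B * weight_sup"
  using feature_sum_bound[of z _ N]
  by (subst average_sum[OF feature_measurable feature_bounded, symmetric]) (auto intro!: abs_average_le)

text \<open>The expansion of \<open>k\<close> is averaged termwise twice, first in one argument and
  then in the other.\<close>

lemma averaged_kernel_sums: "(\<lambda>n. average (e n) x * average (e n) y) sums haar_kernel x y"
proof -
  have "(\<lambda>n. average (e n) x * average (e n) y) sums average (\<lambda>z. average (k z) x) y"
    using average_kernel_sums average_kernel_sum_bound
    by (intro average_sums[OF feature_measurable feature_bounded]) (auto simp: mult.commute)
  also have "average (\<lambda>z. average (k z) x) y = haar_kernel x y"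
  proof -
    \<comment> \<open>The inner average runs over the second argument of \<open>k\<close>, while
      \<open>averaged_kernel\<close> integrates the first argument inside; symmetry reconciles
      them.\<close>
    have "k z w = k w z" for z w using positive_definite_on_sym[OF positive_definite] by simp
    then show ?thesis
      by (simp add: average_def averaged_kernel_def weighted_kernel_def mult.commute)
  qed
  finally show ?thesis .
qed

lemma averaged_kernel_diag_le: "haar_kernel x x \<le> B * weight_sup * weight_sup"
proof (rule LIMSEQ_le_const2)
  show "(\<lambda>N. \<Sum>n<N. average (e n) x * average (e n) x) \<longlonglongrightarrow> haar_kernel x x"
    using averaged_kernel_sums by (simp add: sums_def)
  have "(\<Sum>n<N. average (e n) x * average (e n) x) \<le> B * weight_sup * weight_sup" for N
  proof -
    \<comment> \<open>The partial sum is itself an average of a function bounded by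
      \<open>B * weight_sup\<close>; each averaging costs one factor
      \<open>weight_sup\<close>.\<close>
    have "\<bar>average (\<lambda>z. \<Sum>n<N. average (e n) x * e n z) x\<bar> \<le> B * weight_sup * weight_sup"
      using average_kernel_sum_bound[of _ x N] by (intro abs_average_le) (auto simp: mult.commute)
    then show ?thesis
      by (simp add: average_sum[OF feature_measurable feature_bounded])
  qed
  then show "\<exists>N. \<forall>M\<ge>N. (\<Sum>n<M. average (e n) x * average (e n) x) \<le> B * weight_sup * weight_sup"
    by blast
qed

text \<open>Invariance is read off from the invariant features in the expansion.\<close>

lemma averaged_kernel_action: "haar_kernel (\<phi> g x) y = haar_kernel x y" "haar_kernel x (\<phi> g y) = haar_kernel x y"
  using averaged_kernel_sums[of "\<phi> g x" y] averaged_kernel_sums[of x "\<phi> g y"] averaged_kernel_sums[of x y]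
  by (simp_all add: average_invariant sums_iff)

definition orbit_feature :: "nat \<Rightarrow> 'x set \<Rightarrow> real" where
  "orbit_feature n = on_orbits (average (e n))"

definition orbit_kernel :: "'x set \<Rightarrow> 'x set \<Rightarrow> real" where
  "orbit_kernel a b = on_orbits (\<lambda>x. on_orbits (haar_kernel x) b) a"

lemma orbit_feature_orbit: "orbit_feature n (orbit \<phi> x) = average (e n) x"
  unfolding orbit_feature_def by (intro on_orbits_orbit average_invariant) simp

lemma orbit_kernel_orbit: "orbit_kernel (orbit \<phi> x) (orbit \<phi> y) = haar_kernel x y"
  by (simp add: orbit_kernel_def on_orbits_orbit averaged_kernel_action)

text \<open>The averaged features descend to orbits, so measurability, positive definiteness and
  membership of mean embeddings in the reproducing kernel Hilbert space follow for the induced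
  kernel.\<close>

sublocale orbit: bounded_features "orbit_space \<phi>" orbit_feature orbit_kernel "B * weight_sup * weight_sup"
proof
  show "orbit_feature n \<in> borel_measurable (orbit_space \<phi>)" for n
    unfolding orbit_feature_def by (intro on_orbits_measurable average_invariant) auto
qed (auto simp: space_orbit_space orbit_feature_orbit orbit_kernel_orbit averaged_kernel_sums
    averaged_kernel_diag_le)

lemma sweep_eq_if_mean_embedding_eq:
  assumes char: "characteristic_on_signed k finite_signed_measures"
    and P: "prob_space P" "sets P = sets borel" and Q: "prob_space Q" "sets Q = sets borel"
    and eq: "mean_embedding orbit_kernel (distr P (orbit_space \<phi>) (orbit \<phi>)) =
      mean_embedding orbit_kernel (distr Q (orbit_space \<phi>) (orbit \<phi>))"
  shows "sweep P = sweep Q"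
proof -
  have meas: "orbit \<phi> \<in> P \<rightarrow>\<^sub>M orbit_space \<phi>" "orbit \<phi> \<in> Q \<rightarrow>\<^sub>M orbit_space \<phi>"
    using measurable_orbit P(2) Q(2) measurable_cong_sets by blast+
  \<comment> \<open>Sweeping is dual to averaging: both sides equal the integral of
    \<open>average (e n)\<close> over \<open>R\<close>.\<close>
  have sweep: "(\<integral>z. e n z \<partial>sweep R) = (\<integral>a. orbit_feature n a \<partial>distr R (orbit_space \<phi>) (orbit \<phi>))"
    if R: "prob_space R" "sets R = sets borel" "orbit \<phi> \<in> R \<rightarrow>\<^sub>M orbit_space \<phi>" for R n
    by (simp add: integral_sweep[OF R(1,2) feature_measurable feature_bounded]
        integral_distr[OF R(3) orbit.features_measurable] orbit_feature_orbit)
  have "(\<integral>z. e n z \<partial>sweep P) = (\<integral>z. e n z \<partial>sweep Q)" for n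
    unfolding sweep[OF P meas(1)] sweep[OF Q meas(2)]
    by (rule orbit.integral_features_eq_if_mean_embedding_eq[OF _ _ _ _ eq])
      (auto intro: prob_space.prob_space_distr P Q meas)
  \<comment> \<open>Equal feature integrals give equal embeddings under \<open>k\<close>, through
    the expansion of \<open>k y x\<close>.\<close>
  then have "(\<integral>x. k y x \<partial>sweep P) = (\<integral>x. k y x \<partial>sweep Q)" for y
    using integral_kernel_sums[OF finite_measure_sweep[OF P] sets_sweep, of y]
      integral_kernel_sums[OF finite_measure_sweep[OF Q] sets_sweep, of y] by (simp add: sums_iff)
  then show ?thesis
    by (intro characteristic_on_signed_measure_eqI[OF char] finite_measure_sweep sets_sweep P Q)
qed

lemma orbit_kernel_characteristic:
  assumes "characteristic_on_signed k finite_signed_measures"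
  shows "characteristic_on (range (orbit \<phi>)) orbit_kernel
    {distr P (orbit_space \<phi>) (orbit \<phi>) | P. prob_space P \<and> sets P = sets borel}"
  unfolding characteristic_on_def
proof (intro conjI ballI inj_onI)
  fix \<mu> assume "\<mu> \<in> {distr P (orbit_space \<phi>) (orbit \<phi>) | P. prob_space P \<and> sets P = sets borel}"
  then obtain P where P: "prob_space P" "sets P = sets borel" "\<mu> = distr P (orbit_space \<phi>) (orbit \<phi>)"
    by blast
  have "orbit \<phi> \<in> P \<rightarrow>\<^sub>M orbit_space \<phi>"
    using measurable_orbit P(2) measurable_cong_sets by blast
  then have "prob_space \<mu>" using P by (simp add: prob_space.prob_space_distr)
  then show "mean_embedding orbit_kernel \<mu> \<in> rkhs (range (orbit \<phi>)) orbit_kernel"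
    using orbit.mean_embedding_in_rkhs[of \<mu>] P(3) by (simp add: space_orbit_space)
qed (use distr_orbit_eq_if_sweep_eq sweep_eq_if_mean_embedding_eq[OF assms] in blast)

end

theorem mainTheorem2:
  fixes \<phi> :: "'g::{topological_group_add, t2_space} \<Rightarrow> 'x::polish_space \<Rightarrow> 'x"
    and \<eta> :: "'g measure"
    and k :: "'x \<Rightarrow> 'x \<Rightarrow> real"
    and \<rho> :: "'x \<Rightarrow> real"
  assumes "locally_compact_space (euclidean :: 'g topology)"
    and "sigma_compact_space TYPE('g)"
    and "unimodular_haar_measure \<eta>"
    and "measurable_action \<phi>"
    and "continuous_on UNIV (\<lambda>(x, y). k x y)"
    and "bounded (range (\<lambda>(x, y). k x y))"
    and "positive_definite_on UNIV k"
    and "characteristic_on_signed k finite_signed_measures"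
    and "continuous_on UNIV \<rho>"
    and "bounded (range \<rho>)"
    and "\<forall>x. 0 < \<rho> x"
    and "\<eta> \<in> weighted_measures \<phi> \<rho>"
  defines "kavg \<equiv> averaged_kernel \<phi> \<eta> (weighted_kernel \<rho> k)"
  shows "(\<forall>x y x' y'. x' \<in> orbit \<phi> x \<longrightarrow> y' \<in> orbit \<phi> y \<longrightarrow> kavg x' y' = kavg x y) \<and>
    (\<exists>kq :: 'x set \<Rightarrow> 'x set \<Rightarrow> real.
      (\<forall>x y. kq (orbit \<phi> x) (orbit \<phi> y) = kavg x y) \<and>
      (\<lambda>(a, b). kq a b) \<in> borel_measurable (orbit_space \<phi> \<Otimes>\<^sub>M orbit_space \<phi>) \<and>
      positive_definite_on (range (orbit \<phi>)) kq \<and>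
      characteristic_on (range (orbit \<phi>)) kq
        {distr P (orbit_space \<phi>) (orbit \<phi>) | P. prob_space P \<and> sets P = sets borel})"
proof -
  obtain e B where "bounded_features borel e k B"
    using bounded_continuous_positive_definite_features assms(5-7) by blast
  moreover have "weighted_action \<phi> \<eta> \<rho>"
    using assms(3,4,9,11,12) by unfold_locales (auto intro: borel_measurable_continuous_onI)
  ultimately interpret averaged_features \<phi> \<eta> \<rho> e k B
    by (intro averaged_features.intro)
  show ?thesis
    unfolding kavg_def
    by (intro conjI exI[of _ orbit_kernel] allI impI orbit_kernel_orbit orbit.kernel_measurable
        orbit.positive_definite[unfolded space_orbit_space] orbit_kernel_characteristic assms(8))
      (auto simp: orbit_def averaged_kernel_action)
qed

end
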